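(* Let $A$ and $B$ be finitely presented groups, set $G = A \times B$, and let $\{U_n\}_{n=1}^\infty$ be a sequence of finite index subgroups of $G$. Assume that $[A : A \cap U_n] \to \infty$ and $[B : B \cap U_n] \to \infty$ as $n \to \infty$ (where $A$ and $B$ are identified with the subgroups $A \times \{1\}$ and $\{1\} \times B$ of $G$). Then $$\lim_{n \to \infty} \frac{\log |\mathrm{Torsion}(U_n^{\mathrm{ab}})|}{[G : U_n]} = 0.$$
   Context: For a group $K$, $K^{\mathrm{ab}} = K/[K,K]$ is its abelianization, and $\mathrm{Torsion}(M)$ denotes the torsion subgroup of an abelian group $M$ (finite here, since $U_n^{\mathrm{ab}}$ is finitely generated). $\log$ is the natural logarithm. *)

theory Defs
  imports "HOL-Algebra.Algebra" "HOL-Analysis.Analysis"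
begin

(* Words in the free group on generators indexed by nat: (True, i) is the inverse of generator i. *)
type_synonym fg_word = "(bool \<times> nat) list"

definition word_eval :: "('a, 'c) monoid_scheme \<Rightarrow> (nat \<Rightarrow> 'a) \<Rightarrow> fg_word \<Rightarrow> 'a" where
  "word_eval G f w =
     foldr (\<lambda>(b, i) acc. (if b then inv\<^bsub>G\<^esub> (f i) else f i) \<otimes>\<^bsub>G\<^esub> acc) w \<one>\<^bsub>G\<^esub>"

(* The congruence on words generated by free cancellation and the relators R,
   i.e. equality in the group presented by R. *)
inductive pres_equiv :: "fg_word set \<Rightarrow> fg_word \<Rightarrow> fg_word \<Rightarrow> bool" for R where
  refl: "pres_equiv R w w"
| sym: "pres_equiv R u v \<Longrightarrow> pres_equiv R v u"
| trans: "pres_equiv R u v \<Longrightarrow> pres_equiv R v w \<Longrightarrow> pres_equiv R u w"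
| cancel: "pres_equiv R (u @ [(b, i), (\<not> b, i)] @ v) (u @ v)"
| relator: "r \<in> R \<Longrightarrow> pres_equiv R (u @ r @ v) (u @ v)"

(* G is finitely presented: G is isomorphic to < x_0, ..., x_{k-1} | R > with R finite,
   the isomorphism being induced by x_i \<mapsto> f i. *)
definition finitely_presented :: "('a, 'c) monoid_scheme \<Rightarrow> bool" where
  "finitely_presented G \<longleftrightarrow> group G \<and>
     (\<exists>(k::nat) (f::nat \<Rightarrow> 'a) (R::fg_word set).
        finite R \<and>
        (\<forall>r\<in>R. snd ` set r \<subseteq> {..<k}) \<and>
        (\<forall>i. f i \<in> carrier G) \<and>
        generate G (f ` {..<k}) = carrier G \<and>
        (\<forall>w. snd ` set w \<subseteq> {..<k} \<longrightarrow> (word_eval G f w = \<one>\<^bsub>G\<^esub> \<longleftrightarrow> pres_equiv R w [])))"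

definition abelianization :: "('a, 'c) monoid_scheme \<Rightarrow> 'a set monoid" where
  "abelianization K = K Mod derived K (carrier K)"

definition torsion :: "('a, 'c) monoid_scheme \<Rightarrow> 'a set" where
  "torsion M = {x \<in> carrier M. \<exists>n::nat. n > 0 \<and> x [^]\<^bsub>M\<^esub> n = \<one>\<^bsub>M\<^esub>}"

end

theory Submission
  imports Defs "HOL-Real_Asymp.Real_Asymp"
begin

text \<open>
  Write \<open>P\<close>, \<open>Q\<close> for the projections of \<open>U = U\<^sub>n\<close> to \<open>A\<close>, \<open>B\<close>, and \<open>N = B \<inter> U\<close>, a normal subgroup of \<open>Q\<close>.
  The kernel of \<open>U\<^sup>a\<^sup>b \<rightarrow> P\<^sup>a\<^sup>b \<times> Q\<^sup>a\<^sup>b\<close> is a quotient of \<open>(N \<inter> [Q, Q]) / [N, Q]\<close>, so the torsion of \<open>U\<^sup>a\<^sup>b\<close>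
  is bounded by a product of three numbers.

  The torsion of \<open>P\<^sup>a\<^sup>b\<close> has at most \<open>c ^ [A : P]\<close> elements, with \<open>c\<close> depending only on a presentation of
  \<open>A\<close>: in the covering of the presentation complex, a torsion class is a rational combination of
  relator chains, and may be changed by an integral combination so that all coefficients lie in
  \<open>[0, 1)\<close>; its entries are then bounded by the total length of the relators. As
  \<open>[A : P] [B : B \<inter> U] \<le> [G : U]\<close>, this contributes \<open>O(1 / [B : B \<inter> U])\<close> to the quotient; \<open>Q\<close> is symmetric.

  The group \<open>(N \<inter> [Q, Q]) / [N, Q]\<close> is the intersection of a central subgroup of index \<open>F = [Q : N] \<le> [G : U]\<close>
  with the derived group. By transfer to preimages of Sylow subgroups and the bound of Wiegold's type
  for the derived group of a central extension of a \<open>p\<close>-group, its order is at most \<open>F ^ log\<^sub>2 F\<close>, whose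
  logarithm is \<open>o([G : U])\<close>.
\<close>

section \<open>Schreier transversals and transfer\<close>

text \<open>The obstacle is the third factor. If \<open>U\<close> is the fibre product of
  \<open>A\<close> and \<open>B\<close> over a finite group C, then P = A, Q = B and F = |C| =
  [G : U], so an estimate exponential in F, like the one for P and Q, would give nothing: the bound
  must be subexponential in F. Commutators with N vanish because [(1, n), (p, q)] = (1, [n, q]) is a
  commutator in U; this leaves a central extension of the finite group Q / N. Over a p-group, the
  derived group is built up along a chain of subgroups V, each normal in the next and enlarged by
  one generator x. An enlargement at least doubles V and multiplies the order of the derived group
  of the preimage by at most |V|, so the number of factors is logarithmic. Such a chain requires
  proper subgroups to have strictly larger normalizers, which fails in general finite groups; this
  is what forces the passage to Sylow subgroups.\<close>

lemma (in group) inv_cancel_left [simp]: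
  "x \<in> carrier G \<Longrightarrow> y \<in> carrier G \<Longrightarrow> inv x \<otimes> (x \<otimes> y) = y"
  "x \<in> carrier G \<Longrightarrow> y \<in> carrier G \<Longrightarrow> x \<otimes> (inv x \<otimes> y) = y"
  by (simp_all add: m_assoc [symmetric])

definition coset_rep :: "'a set \<Rightarrow> 'a" where
  "coset_rep C = (SOME g. g \<in> C)"

text \<open>The Schreier cocycle of the right cosets. The representative of a subgroup
  \<open>H\<close> is an arbitrary element of \<open>H\<close> rather than the identity, so for
  \<open>g\<close> in \<open>H\<close> the value at the coset \<open>H\<close> is only a conjugate
  of \<open>g\<close> by an element of \<open>H\<close>.\<close>

definition schreier :: "('a, 'c) monoid_scheme \<Rightarrow> 'a set \<Rightarrow> 'a \<Rightarrow> 'a" where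
  "schreier G C g = coset_rep C \<otimes>\<^bsub>G\<^esub> g \<otimes>\<^bsub>G\<^esub> inv\<^bsub>G\<^esub> (coset_rep (C #>\<^bsub>G\<^esub> g))"

context group
begin

lemma coset_rep:
  assumes "subgroup H G" and "C \<in> rcosets H"
  shows "coset_rep C \<in> C" "coset_rep C \<in> carrier G" "H #> coset_rep C = C"
proof -
  obtain g where g: "g \<in> carrier G" "C = H #> g"
    using assms(2) by (auto simp: RCOSETS_def)
  have "g \<in> C" using g assms(1) rcos_self by blast
  then show 1: "coset_rep C \<in> C" unfolding coset_rep_def by (rule someI)
  then show 2: "coset_rep C \<in> carrier G"
    using assms subgroup.rcosets_carrier[OF assms(1) is_group] by blast
  show "H #> coset_rep C = C"
    using 1 g repr_independence[OF _ g(1) assms(1)] by metis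
qed

lemma rcosets_translate:
  assumes "subgroup H G" and "C \<in> rcosets H" and "g \<in> carrier G"
  shows "C #> g \<in> rcosets H"
proof -
  have "C #> g = H #> (coset_rep C \<otimes> g)"
    using coset_rep[OF assms(1,2)] assms coset_mult_assoc[OF subgroup.subset[OF assms(1)]] by metis
  then show ?thesis
    using coset_rep(2)[OF assms(1,2)] assms rcosetsI[OF subgroup.subset[OF assms(1)]] by simp
qed

lemma rcosets_translate_mult:
  assumes "subgroup H G" and "C \<in> rcosets H" and "g \<in> carrier G" and "h \<in> carrier G"
  shows "C #> g #> h = C #> (g \<otimes> h)"
  using coset_mult_assoc assms subgroup.rcosets_carrier[OF assms(1) is_group assms(2)] by blast

lemma bij_betw_rcosets_translate:
  assumes "subgroup H G" and "g \<in> carrier G"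
  shows "bij_betw (\<lambda>C. C #> g) (rcosets H) (rcosets H)"
proof (rule bij_betwI[where g = "\<lambda>C. C #> inv g"])
  show "(\<lambda>C. C #> g) \<in> rcosets H \<rightarrow> rcosets H" "(\<lambda>C. C #> inv g) \<in> rcosets H \<rightarrow> rcosets H"
    using assms rcosets_translate by auto
  fix C assume C: "C \<in> rcosets H"
  have "C \<subseteq> carrier G" using subgroup.rcosets_carrier[OF assms(1) is_group C] .
  then show "C #> g #> inv g = C" "C #> inv g #> g = C"
    using assms C by (simp_all add: rcosets_translate_mult)
qed

lemma schreier_closed:
  assumes "subgroup H G" and "C \<in> rcosets H" and "g \<in> carrier G"
  shows "schreier G C g \<in> H"
proof -
  let ?t = "coset_rep C" and ?u = "coset_rep (C #> g)"
  have u: "?u \<in> C #> g" "?u \<in> carrier G" 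
    using coset_rep[OF assms(1) rcosets_translate[OF assms]] by auto
  have t: "?t \<in> carrier G" "H #> ?t = C" using coset_rep[OF assms(1,2)] by auto
  have "C #> g = H #> (?t \<otimes> g)"
    using t assms coset_mult_assoc[OF subgroup.subset[OF assms(1)]] by metis
  then have "?t \<otimes> g \<in> H #> ?u"
    using rcos_self[OF _ assms(1), of "?t \<otimes> g"] t assms(3) coset_rep(3)[OF assms(1) rcosets_translate[OF assms]] by simp
  then show ?thesis unfolding schreier_def
    using subgroup.rcos_module_imp[OF assms(1) is_group u(2)] by simp
qed

text \<open>The middle representative cancels. This cocycle identity makes the transfer a
  homomorphism and lets chains be evaluated letter by letter.\<close>

lemma schreier_mult:
  assumes "subgroup H G" and "C \<in> rcosets H" and "g \<in> carrier G" and "h \<in> carrier G"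
  shows "schreier G C (g \<otimes> h) = schreier G C g \<otimes> schreier G (C #> g) h"
proof -
  have "coset_rep C \<in> carrier G" "coset_rep (C #> g) \<in> carrier G" "coset_rep (C #> g #> h) \<in> carrier G"
    using assms by (auto intro!: coset_rep(2) rcosets_translate)
  then show ?thesis using assms
    by (simp add: schreier_def rcosets_translate_mult m_assoc)
qed

lemma hom_derived_eq_one:
  assumes "comm_group M" and "h \<in> hom G M" and "g \<in> derived G (carrier G)"
  shows "h g = \<one>\<^bsub>M\<^esub>"
proof -
  interpret M: comm_group M by fact
  interpret group_hom G M h using assms by unfold_locales
  have "derived M (h ` carrier G) = {\<one>\<^bsub>M\<^esub>}" by (rule M.derived_eq_singleton) auto
  then show ?thesis using derived_img[of "carrier G"] assms(3) by auto
qed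

text \<open>The transfer. The cocycle identity splits the product because \<open>M\<close> is
  commutative; the second factor runs over the translated cosets, which are a permutation of all
  cosets.\<close>

lemma transfer_hom:
  assumes H: "subgroup H G" "finite (rcosets H)" and M: "comm_group M"
    and h: "h \<in> hom (G\<lparr>carrier := H\<rparr>) M"
  shows "(\<lambda>g. finprod M (\<lambda>C. h (schreier G C g)) (rcosets H)) \<in> hom G M"
proof (rule homI)
  interpret M: comm_group M by fact
  have h_closed: "h a \<in> carrier M" if "a \<in> H" for a using h that by (auto simp: hom_def)
  have h_mult: "h (a \<otimes> b) = h a \<otimes>\<^bsub>M\<^esub> h b" if "a \<in> H" "b \<in> H" for a b
    using h that by (auto simp: hom_def)
  have cl: "h (schreier G C g) \<in> carrier M" if "C \<in> rcosets H" "g \<in> carrier G" for C g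
    using h_closed schreier_closed[OF H(1) that] .
  show "finprod M (\<lambda>C. h (schreier G C g)) (rcosets H) \<in> carrier M" if "g \<in> carrier G" for g
    using cl that by (intro M.finprod_closed) auto
  fix g k assume gk: "g \<in> carrier G" "k \<in> carrier G"
  have "finprod M (\<lambda>C. h (schreier G C (g \<otimes> k))) (rcosets H)
      = finprod M (\<lambda>C. h (schreier G C g) \<otimes>\<^bsub>M\<^esub> h (schreier G (C #> g) k)) (rcosets H)"
    using gk H cl by (intro M.finprod_cong') (auto simp: schreier_mult h_mult schreier_closed rcosets_translate)
  also have "\<dots> = finprod M (\<lambda>C. h (schreier G C g)) (rcosets H)
      \<otimes>\<^bsub>M\<^esub> finprod M (\<lambda>C. h (schreier G (C #> g) k)) (rcosets H)"
    using gk cl H by (intro M.finprod_multf) (auto intro: rcosets_translate)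
  also have "finprod M (\<lambda>C. h (schreier G (C #> g) k)) (rcosets H)
      = finprod M (\<lambda>C. h (schreier G C k)) ((\<lambda>C. C #> g) ` (rcosets H))"
    using gk cl H bij_betw_rcosets_translate[OF H(1) gk(1)]
    by (intro M.finprod_reindex[symmetric]) (auto simp: bij_betw_def intro: rcosets_translate)
  also have "(\<lambda>C. C #> g) ` (rcosets H) = rcosets H"
    using bij_betw_rcosets_translate[OF H(1) gk(1)] by (auto simp: bij_betw_def)
  finally show "finprod M (\<lambda>C. h (schreier G C (g \<otimes> k))) (rcosets H) =
    finprod M (\<lambda>C. h (schreier G C g)) (rcosets H) \<otimes>\<^bsub>M\<^esub> finprod M (\<lambda>C. h (schreier G C k)) (rcosets H)" .
qed

lemma schreier_central:
  assumes "subgroup H G" and "C \<in> rcosets H" and "z \<in> H"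
    and central: "\<And>g. g \<in> carrier G \<Longrightarrow> z \<otimes> g = g \<otimes> z"
  shows "schreier G C z = z"
proof -
  have z: "z \<in> carrier G" using assms subgroup.mem_carrier by metis
  have t: "coset_rep C \<in> carrier G" "H #> coset_rep C = C" using coset_rep[OF assms(1,2)] by auto
  have "C #> z = H #> (coset_rep C \<otimes> z)"
    using t z coset_mult_assoc[OF subgroup.subset[OF assms(1)]] by metis
  also have "\<dots> = H #> z #> coset_rep C"
    using t z coset_mult_assoc[OF subgroup.subset[OF assms(1)]] central by metis
  also have "H #> z = H" using assms z coset_join2 by blast
  finally have "C #> z = C" using t by simp
  then show ?thesis unfolding schreier_def using t z by (simp add: central[symmetric] m_assoc)
qed

text \<open>The transfer into the abelianization of \<open>H\<close> kills
  \<open>derived G (carrier G)\<close>, while on a central element of \<open>H\<close> every cocycle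
  value is that element itself, so the transfer is the power by the index. Hence this power vanishes
  in the abelianization of \<open>H\<close>.\<close>

lemma derived_central_power_mem_derived:
  assumes H: "subgroup H G" "finite (rcosets H)" and z: "z \<in> H" "z \<in> derived G (carrier G)"
    and central: "\<And>g. g \<in> carrier G \<Longrightarrow> z \<otimes> g = g \<otimes> z"
  shows "z [^] card (rcosets H) \<in> derived G H"
proof -
  let ?K = "G\<lparr>carrier := H\<rparr>"
  let ?D = "derived ?K (carrier ?K)"
  interpret K: group ?K using H subgroup_imp_group by blast
  interpret D: normal ?D ?K by (rule K.derived_is_normal[OF K.normal_self])
  let ?M = "?K Mod ?D" let ?h = "\<lambda>g. ?D #>\<^bsub>?K\<^esub> g"
  interpret M: comm_group ?M by (rule K.derived_quot_is_comm_group)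
  have h: "?h \<in> hom ?K ?M" by (rule D.r_coset_hom_Mod)
  have zK: "z \<in> carrier ?K" using z by simp
  have hz: "?h z \<in> carrier ?M" using h zK by (auto simp: hom_def)
  have "\<one>\<^bsub>?M\<^esub> = finprod ?M (\<lambda>C. ?h (schreier G C z)) (rcosets H)"
    using hom_derived_eq_one[OF M.comm_group_axioms transfer_hom[OF H M.comm_group_axioms h] z(2)] by simp
  also have "\<dots> = finprod ?M (\<lambda>C. ?h z) (rcosets H)"
    using hz schreier_central[OF H(1) _ z(1) central] by (intro M.finprod_cong') auto
  also have "\<dots> = ?h z [^]\<^bsub>?M\<^esub> card (rcosets H)" using hz by (rule M.finprod_const)
  also have "\<dots> = ?h (z [^]\<^bsub>?K\<^esub> card (rcosets H))" using D.FactGroup_pow[OF zK] by simp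
  finally have "?h (z [^]\<^bsub>?K\<^esub> card (rcosets H)) = ?D" by simp
  then have "z [^]\<^bsub>?K\<^esub> card (rcosets H) \<in> ?D"
    by (metis D.subgroup_axioms K.nat_pow_closed K.rcos_self zK)
  then show ?thesis
    using derived_consistent[OF _ H(1)] by (simp add: nat_pow_consistent[symmetric])
qed

end

section \<open>Torsion in finite index subgroups of finitely presented groups\<close>

definition letter_eval :: "('a, 'c) monoid_scheme \<Rightarrow> (nat \<Rightarrow> 'a) \<Rightarrow> bool \<times> nat \<Rightarrow> 'a" where
  "letter_eval G f l = (if fst l then inv\<^bsub>G\<^esub> (f (snd l)) else f (snd l))"

lemma word_eval_simps [simp]:
  "word_eval G f [] = \<one>\<^bsub>G\<^esub>"
  "word_eval G f (l # w) = letter_eval G f l \<otimes>\<^bsub>G\<^esub> word_eval G f w"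
  by (auto simp: word_eval_def letter_eval_def split: prod.splits)

text \<open>The 1-chain, in the covering space with vertex set the cosets of \<open>H\<close> and edges
  \<open>(C, i)\<close> from \<open>C\<close> to \<open>C \<cdot> f i\<close>, of the lift of a word starting at the vertex \<open>C\<close>.\<close>

fun chain :: "('a, 'c) monoid_scheme \<Rightarrow> (nat \<Rightarrow> 'a) \<Rightarrow> 'a set \<Rightarrow> fg_word \<Rightarrow> 'a set \<times> nat \<Rightarrow> int" where
  "chain G f C [] = (\<lambda>e. 0)"
| "chain G f C (l # w) = (\<lambda>e.
     (if fst l then - of_bool (e = (C #>\<^bsub>G\<^esub> letter_eval G f l, snd l)) else of_bool (e = (C, snd l)))
     + chain G f (C #>\<^bsub>G\<^esub> letter_eval G f l) w e)"

definition word_inv :: "fg_word \<Rightarrow> fg_word" where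
  "word_inv w = rev (map (\<lambda>(b, i). (\<not> b, i)) w)"

lemma word_inv_Cons: "word_inv ((b, i) # w) = word_inv w @ [(\<not> b, i)]"
  by (simp add: word_inv_def)

lemma set_word_inv [simp]: "snd ` set (word_inv w) = snd ` set w"
  by (force simp: word_inv_def image_iff)

section \<open>Lifts of words to the coset covering and integral boundaries\<close>

locale generated_cover = group G for G :: "('a, 'c) monoid_scheme" (structure) +
  fixes f :: "nat \<Rightarrow> 'a" and H :: "'a set"
  assumes f_closed [simp]: "f i \<in> carrier G" and subgroup_H: "subgroup H G"
begin

lemma letter_eval_closed [simp]: "letter_eval G f l \<in> carrier G"
  by (simp add: letter_eval_def)

lemma word_eval_closed [simp]: "word_eval G f w \<in> carrier G"
  by (induction w) auto

lemma word_eval_append [simp]: "word_eval G f (u @ v) = word_eval G f u \<otimes> word_eval G f v"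
  by (induction u) (auto simp: m_assoc)

lemma rcosets_one [simp]: "C \<in> rcosets H \<Longrightarrow> C #> \<one> = C"
  using subgroup.rcosets_carrier[OF subgroup_H is_group] by simp

lemma translate_closed [simp]: "C \<in> rcosets H \<Longrightarrow> g \<in> carrier G \<Longrightarrow> C #> g \<in> rcosets H"
  by (rule rcosets_translate[OF subgroup_H])

lemma translate_mult [simp]:
  "C \<in> rcosets H \<Longrightarrow> g \<in> carrier G \<Longrightarrow> h \<in> carrier G \<Longrightarrow> C #> g #> h = C #> (g \<otimes> h)"
  by (rule rcosets_translate_mult[OF subgroup_H])

lemma chain_append:
  "C \<in> rcosets H \<Longrightarrow>
    chain G f C (u @ v) e = chain G f C u e + chain G f (C #> word_eval G f u) v e"
  by (induction u arbitrary: C) auto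

lemma inverse_letters:
  "word_eval G f [(b, i), (\<not> b, i)] = \<one>"
  "C \<in> rcosets H \<Longrightarrow> chain G f C [(b, i), (\<not> b, i)] e = 0"
  by (auto simp: letter_eval_def)

lemma word_eval_word_inv [simp]: "word_eval G f (word_inv w) = inv (word_eval G f w)"
proof (induction w)
  case (Cons l w)
  have "letter_eval G f (\<not> fst l, snd l) = inv (letter_eval G f l)"
    by (auto simp: letter_eval_def)
  with Cons show ?case by (cases l) (auto simp: word_inv_def inv_mult_group)
qed (auto simp: word_inv_def)

text \<open>The inverse word, read from the endpoint of a lift, traverses the same edges
  backwards.\<close>

lemma chain_word_inv:
  "C \<in> rcosets H \<Longrightarrow> chain G f (C #> word_eval G f w) (word_inv w) e = - chain G f C w e"
proof (induction w arbitrary: C)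
  case (Cons l w)
  obtain b i where l: "l = (b, i)" by (cases l)
  have "chain G f (C #> word_eval G f (l # w)) (word_inv (l # w)) e
      = chain G f (C #> letter_eval G f l #> word_eval G f w) (word_inv w) e
        + chain G f (C #> letter_eval G f l) [(\<not> b, i)] e"
    using Cons.prems
    by (simp add: l word_inv_Cons chain_append m_assoc del: chain.simps)
  also have "\<dots> = - chain G f (C #> letter_eval G f l) w e + chain G f (C #> letter_eval G f l) [(\<not> b, i)] e"
    using Cons.prems Cons.IH by (simp del: translate_mult)
  finally show ?case using Cons.prems by (auto simp: l letter_eval_def)
qed (auto simp: word_inv_def)

text \<open>Over all starting cosets together, each letter of \<open>w\<close> crosses a given edge
  at most once, since translation by a prefix permutes the cosets. The bound is free of the index of
  \<open>H\<close>, which keeps the final constant uniform.\<close>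

lemma sum_abs_chain_le:
  assumes "finite (rcosets H)"
  shows "(\<Sum>C\<in>rcosets H. \<bar>chain G f C w e\<bar>) \<le> int (length w)"
proof (induction w)
  case (Cons l w)
  define s where "s C = (if fst l then - of_bool (e = (C #> letter_eval G f l, snd l)) else of_bool (e = (C, snd l)) :: int)" for C
  have bij: "bij_betw (\<lambda>C. C #> letter_eval G f l) (rcosets H) (rcosets H)"
    by (rule bij_betw_rcosets_translate[OF subgroup_H]) simp
  have delta: "(\<Sum>C\<in>rcosets H. of_bool (e = (C, snd l)) :: int) \<le> 1"
  proof -
    have "(\<Sum>C\<in>rcosets H. of_bool (e = (C, snd l)) :: int) = (\<Sum>C\<in>rcosets H. if C = fst e then of_bool (snd e = snd l) else 0)"
      by (intro sum.cong) (auto simp: prod_eq_iff)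
    also have "\<dots> \<le> 1" using assms by (simp add: sum.delta')
    finally show ?thesis .
  qed
  have s: "(\<Sum>C\<in>rcosets H. \<bar>s C\<bar>) \<le> 1"
  proof (cases "fst l")
    case True
    then have "(\<Sum>C\<in>rcosets H. \<bar>s C\<bar>) = (\<Sum>C\<in>rcosets H. of_bool (e = (C #> letter_eval G f l, snd l)))"
      by (simp add: s_def)
    also have "\<dots> = (\<Sum>C\<in>rcosets H. of_bool (e = (C, snd l)))"
      by (rule sum.reindex_bij_betw[OF bij])
    finally show ?thesis using delta by simp
  qed (use delta in \<open>simp add: s_def\<close>)
  have "(\<Sum>C\<in>rcosets H. \<bar>chain G f C (l # w) e\<bar>)
      \<le> (\<Sum>C\<in>rcosets H. \<bar>s C\<bar> + \<bar>chain G f (C #> letter_eval G f l) w e\<bar>)"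
    by (intro sum_mono) (simp add: s_def del: chain.simps(1))
  also have "\<dots> = (\<Sum>C\<in>rcosets H. \<bar>s C\<bar>) + (\<Sum>C\<in>rcosets H. \<bar>chain G f (C #> letter_eval G f l) w e\<bar>)"
    by (rule sum.distrib)
  also have "(\<Sum>C\<in>rcosets H. \<bar>chain G f (C #> letter_eval G f l) w e\<bar>) = (\<Sum>C\<in>rcosets H. \<bar>chain G f C w e\<bar>)"
    by (rule sum.reindex_bij_betw[OF bij])
  finally show ?case using s Cons by simp
qed auto

lemma H_in_rcosets: "H \<in> rcosets H"
  by (rule subgroup.subgroup_in_rcosets[OF subgroup_H is_group])

lemma translate_H: "g \<in> H \<Longrightarrow> H #> g = H"
  using subgroup_H subgroup.mem_carrier coset_join2 by metis

lemma exists_word: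
  assumes "g \<in> generate G (f ` {..<k})"
  shows "\<exists>w. snd ` set w \<subseteq> {..<k} \<and> word_eval G f w = g"
  using assms
proof (induction rule: generate.induct)
  case one show ?case by (rule exI[of _ "[]"]) auto
next
  case (incl h)
  then obtain i where "i < k" "h = f i" by auto
  then show ?case by (intro exI[of _ "[(False, i)]"]) (auto simp: letter_eval_def)
next
  case (inv h)
  then obtain i where "i < k" "h = f i" by auto
  then show ?case by (intro exI[of _ "[(True, i)]"]) (auto simp: letter_eval_def)
next
  case (eng h1 h2)
  then obtain u v where "snd ` set u \<subseteq> {..<k}" "word_eval G f u = h1" "snd ` set v \<subseteq> {..<k}" "word_eval G f v = h2"
    by blast
  then show ?case by (intro exI[of _ "u @ v"]) auto
qed

text \<open>A commutator of elements of \<open>H\<close> is spelled by two loops at the vertex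
  \<open>H\<close> followed by their inverses, so all contributions cancel: the chain is zero on the
  nose, not merely modulo relators.\<close>

lemma derived_chain_zero:
  assumes gen: "generate G (f ` {..<k}) = carrier G" and g: "g \<in> derived G H"
  shows "\<exists>w. snd ` set w \<subseteq> {..<k} \<and> word_eval G f w = g \<and> chain G f H w = (\<lambda>e. 0)"
proof -
  note m = subgroup.m_closed[OF subgroup_H] and i = subgroup.m_inv_closed[OF subgroup_H]
  have comm: "\<exists>w. snd ` set w \<subseteq> {..<k} \<and> word_eval G f w = g \<and> chain G f H w = (\<lambda>e. 0)"
    if "g \<in> derived_set G H" for g
  proof -
    from that obtain a b where ab: "a \<in> H" "b \<in> H" "g = a \<otimes> b \<otimes> inv a \<otimes> inv b" by auto
    obtain u v where u: "snd ` set u \<subseteq> {..<k}" "word_eval G f u = a"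
      and v: "snd ` set v \<subseteq> {..<k}" "word_eval G f v = b"
      using exists_word[of a k] exists_word[of b k] ab gen subgroup.mem_carrier[OF subgroup_H] by auto
    have "chain G f H (u @ v @ word_inv u @ word_inv v) = (\<lambda>e. 0)"
    proof
      fix e
      have "chain G f H (word_inv u) e = - chain G f H u e" "chain G f H (word_inv v) e = - chain G f H v e"
        using chain_word_inv[OF H_in_rcosets, of u e] chain_word_inv[OF H_in_rcosets, of v e] u v ab
        by (simp_all add: translate_H)
      then show "chain G f H (u @ v @ word_inv u @ word_inv v) e = 0"
        using u v ab i by (simp add: chain_append H_in_rcosets translate_H)
    qed
    moreover have "word_eval G f (u @ v @ word_inv u @ word_inv v) = g"
      using u v ab subgroup.mem_carrier[OF subgroup_H] by (simp add: m_assoc)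
    ultimately show ?thesis using u v
      by (intro exI[of _ "u @ v @ word_inv u @ word_inv v"]) (simp add: image_Un)
  qed
  from g have "g \<in> generate G (derived_set G H)" by (simp add: derived_def)
  then show ?thesis
  proof (induction rule: generate.induct)
    case one show ?case by (rule exI[of _ "[]"]) auto
  next
    case (incl h) then show ?case by (rule comm)
  next
    case (inv h)
    obtain w where w: "snd ` set w \<subseteq> {..<k}" "word_eval G f w = h" "chain G f H w = (\<lambda>e. 0)"
      using comm[OF inv] by blast
    have "h \<in> H" using inv derived_set_incl[OF _ subgroup_H] by blast
    then have "chain G f H (word_inv w) = (\<lambda>e. 0)"
      using chain_word_inv[OF H_in_rcosets, of w] w by (auto simp: translate_H)
    then show ?case using w by (intro exI[of _ "word_inv w"]) auto
  next
    case (eng h1 h2)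
    then obtain u v where uv: "snd ` set u \<subseteq> {..<k}" "word_eval G f u = h1" "chain G f H u = (\<lambda>e. 0)"
      "snd ` set v \<subseteq> {..<k}" "word_eval G f v = h2" "chain G f H v = (\<lambda>e. 0)"
      by blast
    have "h1 \<in> H" using eng(1) derived_incl[OF _ subgroup_H] by (auto simp: derived_def)
    then have "chain G f H (u @ v) = (\<lambda>e. 0)"
      using uv by (auto simp: chain_append H_in_rcosets translate_H)
    then show ?case using uv by (intro exI[of _ "u @ v"]) auto
  qed
qed

lemma word_power:
  assumes "word_eval G f w \<in> H"
  shows "word_eval G f (concat (replicate n w)) = word_eval G f w [^] n"
    and "chain G f H (concat (replicate n w)) e = int n * chain G f H w e"
proof -
  have "word_eval G f w \<otimes> word_eval G f w [^] n = word_eval G f w [^] n \<otimes> word_eval G f w" for n :: nat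
    using nat_pow_Suc2 nat_pow_Suc word_eval_closed by metis
  then show "word_eval G f (concat (replicate n w)) = word_eval G f w [^] n"
    and "chain G f H (concat (replicate n w)) e = int n * chain G f H w e"
    using assms by (induction n) (auto simp: chain_append H_in_rcosets translate_H algebra_simps)
qed

text \<open>The integral boundaries in the covering of the presentation complex: its 2-cells are the
  pairs of a coset and a relator, and \<open>n\<close> is an integral 2-chain.\<close>

definition relator_span :: "fg_word set \<Rightarrow> ('a set \<times> nat \<Rightarrow> int) set" where
  "relator_span R = {v. \<exists>n. v = (\<lambda>e. \<Sum>p\<in>(rcosets H) \<times> R. n p * chain G f (fst p) (snd p) e)}"

lemma relator_span_zero: "(\<lambda>e. 0) \<in> relator_span R"
  unfolding relator_span_def by (auto intro!: exI[of _ "\<lambda>p. 0"])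

lemma relator_span_add:
  assumes "u \<in> relator_span R" and "v \<in> relator_span R"
  shows "(\<lambda>e. u e + v e) \<in> relator_span R"
proof -
  from assms obtain m n where "u = (\<lambda>e. \<Sum>p\<in>(rcosets H) \<times> R. m p * chain G f (fst p) (snd p) e)"
    "v = (\<lambda>e. \<Sum>p\<in>(rcosets H) \<times> R. n p * chain G f (fst p) (snd p) e)"
    by (auto simp: relator_span_def)
  then show ?thesis unfolding relator_span_def
    by (auto simp: sum.distrib ring_distribs intro!: exI[of _ "\<lambda>p. m p + n p"])
qed

lemma relator_span_uminus:
  assumes "u \<in> relator_span R"
  shows "(\<lambda>e. - u e) \<in> relator_span R"
proof -
  from assms obtain m where "u = (\<lambda>e. \<Sum>p\<in>(rcosets H) \<times> R. m p * chain G f (fst p) (snd p) e)"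
    by (auto simp: relator_span_def)
  then show ?thesis unfolding relator_span_def
    by (auto simp: sum_negf intro!: exI[of _ "\<lambda>p. - m p"])
qed

lemma relator_span_chain:
  assumes "finite (rcosets H)" and "finite R" and "C \<in> rcosets H" and "r \<in> R"
  shows "chain G f C r \<in> relator_span R"
proof -
  have "chain G f C r e = (\<Sum>p\<in>(rcosets H) \<times> R. of_bool (p = (C, r)) * chain G f (fst p) (snd p) e)" for e
  proof -
    have "(\<Sum>p\<in>(rcosets H) \<times> R. of_bool (p = (C, r)) * chain G f (fst p) (snd p) e)
       = (\<Sum>p\<in>{(C, r)}. of_bool (p = (C, r)) * chain G f (fst p) (snd p) e)"
      using assms by (intro sum.mono_neutral_right) auto
    then show ?thesis by simp
  qed
  then show ?thesis unfolding relator_span_def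
    by (intro CollectI exI[of _ "\<lambda>p. of_bool (p = (C, r))"] ext)
qed

text \<open>Inserting a relator after the prefix \<open>u\<close> adds its lift at the vertex
  reached by \<open>u\<close>; the rest of the path is unchanged because the relator evaluates to
  the identity. The letters are not bounded here: a derivation in \<open>pres_equiv\<close> may pass
  through letters outside the presentation, and chains accordingly have coordinates for all natural
  numbers.\<close>

lemma pres_equiv_chain:
  assumes fin: "finite (rcosets H)" "finite R" and R: "\<And>r. r \<in> R \<Longrightarrow> word_eval G f r = \<one>"
    and equiv: "pres_equiv R u v"
  shows "word_eval G f u = word_eval G f v \<and>
    (\<forall>C\<in>rcosets H. (\<lambda>e. chain G f C u e - chain G f C v e) \<in> relator_span R)"
  using equiv
proof (induction rule: pres_equiv.induct)
  case (refl w)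
  then show ?case by (simp add: relator_span_zero)
next
  case (sym u v)
  then show ?case using relator_span_uminus by fastforce
next
  case (trans u v w)
  have "(\<lambda>e. chain G f C u e - chain G f C w e) \<in> relator_span R" if "C \<in> rcosets H" for C
  proof -
    have "(\<lambda>e. chain G f C u e - chain G f C v e) \<in> relator_span R"
      "(\<lambda>e. chain G f C v e - chain G f C w e) \<in> relator_span R"
      using trans.IH that by auto
    from relator_span_add[OF this] show ?thesis by simp
  qed
  then show ?case using trans.IH by simp
next
  case (cancel u b i v)
  have "(\<lambda>e. chain G f C (u @ [(b, i), (\<not> b, i)] @ v) e - chain G f C (u @ v) e) = (\<lambda>e. 0)"
    if "C \<in> rcosets H" for C
    using that inverse_letters by (simp only: chain_append translate_closed word_eval_closed) simp
  moreover have "word_eval G f (u @ [(b, i), (\<not> b, i)] @ v) = word_eval G f (u @ v)"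
    using inverse_letters(1)[of b i] word_eval_append by (metis l_one word_eval_closed)
  ultimately show ?case using relator_span_zero by simp
next
  case (relator r u v)
  have "(\<lambda>e. chain G f C (u @ r @ v) e - chain G f C (u @ v) e) = chain G f (C #> word_eval G f u) r"
    if "C \<in> rcosets H" for C
    using that R[OF relator] by (simp add: chain_append)
  then show ?case using relator_span_chain[OF fin _ relator] R[OF relator] by simp
qed

end

section \<open>Evaluation of 1-chains in a commutative group\<close>

text \<open>The homomorphism from integral 1-chains to \<open>M\<close> that takes the edge
  \<open>(C, i)\<close> to the image of its Schreier generator. Only edges with \<open>i < k\<close>
  enter, so the product is finite when the index is.\<close>

definition chain_eval ::
    "('a, 'c) monoid_scheme \<Rightarrow> (nat \<Rightarrow> 'a) \<Rightarrow> 'a set \<Rightarrow> nat \<Rightarrow> ('b, 'd) monoid_scheme \<Rightarrow> ('a \<Rightarrow> 'b)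
      \<Rightarrow> ('a set \<times> nat \<Rightarrow> int) \<Rightarrow> 'b" where
  "chain_eval G f H k M h v =
     finprod M (\<lambda>e. h (schreier G (fst e) (f (snd e))) [^]\<^bsub>M\<^esub> v e) ((rcosets\<^bsub>G\<^esub> H) \<times> {..<k})"

locale abelian_cover = generated_cover G f H + M: comm_group M
  for G :: "('a, 'c) monoid_scheme" (structure) and f H and M :: "('b, 'd) monoid_scheme" +
  fixes h :: "'a \<Rightarrow> 'b" and k :: nat
  assumes h: "h \<in> hom (G\<lparr>carrier := H\<rparr>) M" and finite_index: "finite (rcosets H)"
begin

abbreviation "ev \<equiv> chain_eval G f H k M h"

lemma h_closed [simp]: "a \<in> H \<Longrightarrow> h a \<in> carrier M"
  using h by (auto simp: hom_def)

lemma h_mult: "a \<in> H \<Longrightarrow> b \<in> H \<Longrightarrow> h (a \<otimes> b) = h a \<otimes>\<^bsub>M\<^esub> h b"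
  using h by (auto simp: hom_def)

lemma h_one [simp]: "h \<one> = \<one>\<^bsub>M\<^esub>"
  using hom_one[OF h] subgroup_imp_group[OF subgroup_H] M.is_group by simp

lemma schreier_mem [simp]: "C \<in> rcosets H \<Longrightarrow> g \<in> carrier G \<Longrightarrow> schreier G C g \<in> H"
  by (rule schreier_closed[OF subgroup_H])

lemma ev_closed [simp]: "ev v \<in> carrier M"
  unfolding chain_eval_def by (intro M.finprod_closed) auto

lemma ev_add: "ev (\<lambda>e. u e + v e) = ev u \<otimes>\<^bsub>M\<^esub> ev v"
proof -
  have "ev (\<lambda>e. u e + v e) = finprod M (\<lambda>e. h (schreier G (fst e) (f (snd e))) [^]\<^bsub>M\<^esub> u e
      \<otimes>\<^bsub>M\<^esub> h (schreier G (fst e) (f (snd e))) [^]\<^bsub>M\<^esub> v e) ((rcosets H) \<times> {..<k})"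
    unfolding chain_eval_def by (intro M.finprod_cong') (auto simp: M.int_pow_mult)
  also have "\<dots> = ev u \<otimes>\<^bsub>M\<^esub> ev v"
    unfolding chain_eval_def using finite_index by (intro M.finprod_multf) auto
  finally show ?thesis .
qed

lemma ev_zero [simp]: "ev (\<lambda>e. 0) = \<one>\<^bsub>M\<^esub>"
  unfolding chain_eval_def by (simp add: M.finprod_one_eqI)

lemma ev_cong: "(\<And>e. e \<in> (rcosets H) \<times> {..<k} \<Longrightarrow> u e = v e) \<Longrightarrow> ev u = ev v"
  unfolding chain_eval_def by (intro M.finprod_cong') auto

lemma ev_uminus: "ev (\<lambda>e. - u e) = inv\<^bsub>M\<^esub> ev u"
  using ev_add[of "\<lambda>e. - u e" u] by (simp add: M.inv_equality)

lemma ev_single: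
  assumes "C \<in> rcosets H" and "i < k"
  shows "ev (\<lambda>e. of_bool (e = (C, i))) = h (schreier G C (f i))"
proof -
  have "ev (\<lambda>e. of_bool (e = (C, i))) = finprod M (\<lambda>e. if (C, i) = e then h (schreier G (fst e) (f (snd e))) else \<one>\<^bsub>M\<^esub>)
      ((rcosets H) \<times> {..<k})"
    unfolding chain_eval_def by (intro M.finprod_cong') (auto simp: M.int_pow_1)
  also have "\<dots> = h (schreier G (fst (C, i)) (f (snd (C, i))))"
    using assms finite_index by (intro M.finprod_singleton) auto
  finally show ?thesis by simp
qed

lemma schreier_one: "C \<in> rcosets H \<Longrightarrow> schreier G C \<one> = \<one>"
  using coset_rep(2)[OF subgroup_H] by (simp add: schreier_def)

text \<open>By the cocycle identity the Schreier elements of the letters telescope along the lift.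
  An inverse letter crosses an edge backwards, and its Schreier element is inverse to that of the
  edge.\<close>

lemma ev_chain:
  assumes "snd ` set w \<subseteq> {..<k}" and "C \<in> rcosets H"
  shows "ev (chain G f C w) = h (schreier G C (word_eval G f w))"
  using assms
proof (induction w arbitrary: C)
  case Nil
  then show ?case by (simp add: schreier_one)
next
  case (Cons l w)
  define s where "s e = (if fst l then - of_bool (e = (C #> letter_eval G f l, snd l)) else of_bool (e = (C, snd l)) :: int)" for e
  have k: "snd l < k" using Cons.prems by auto
  have s: "ev s = h (schreier G C (letter_eval G f l))"
  proof (cases "fst l")
    case True
    let ?D = "C #> letter_eval G f l"
    have fl: "letter_eval G f l = inv (f (snd l))" using True by (simp add: letter_eval_def)
    have D: "?D \<in> rcosets H" "?D #> f (snd l) = C" using Cons.prems by (simp_all add: fl)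
    have "schreier G ?D (f (snd l)) \<otimes> schreier G C (letter_eval G f l) = \<one>"
      using schreier_mult[OF subgroup_H D(1), of "f (snd l)" "letter_eval G f l"] D schreier_one[OF D(1)]
      by (simp add: fl)
    then have "h (schreier G ?D (f (snd l))) \<otimes>\<^bsub>M\<^esub> h (schreier G C (letter_eval G f l)) = \<one>\<^bsub>M\<^esub>"
      using Cons.prems D h_mult[symmetric] by simp
    then have "h (schreier G C (letter_eval G f l)) = inv\<^bsub>M\<^esub> h (schreier G ?D (f (snd l)))"
      using Cons.prems D M.inv_equality M.m_comm by (metis f_closed h_closed letter_eval_closed schreier_mem)
    moreover have "s = (\<lambda>e. - of_bool (e = (?D, snd l)))" using True by (auto simp: s_def)
    ultimately show ?thesis using D k by (simp add: ev_uminus ev_single)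
  next
    case False
    then have "s = (\<lambda>e. of_bool (e = (C, snd l)))" "letter_eval G f l = f (snd l)"
      by (auto simp: s_def letter_eval_def)
    then show ?thesis using Cons.prems k by (simp add: ev_single)
  qed
  have "chain G f C (l # w) = (\<lambda>e. s e + chain G f (C #> letter_eval G f l) w e)"
    by (simp add: s_def)
  then have "ev (chain G f C (l # w)) = ev s \<otimes>\<^bsub>M\<^esub> ev (chain G f (C #> letter_eval G f l) w)"
    by (simp only: ev_add)
  also have "\<dots> = h (schreier G C (letter_eval G f l)) \<otimes>\<^bsub>M\<^esub> h (schreier G (C #> letter_eval G f l) (word_eval G f w))"
    using s Cons by simp
  also have "\<dots> = h (schreier G C (word_eval G f (l # w)))"
    using Cons.prems by (simp add: schreier_mult[OF subgroup_H] h_mult)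
  finally show ?case .
qed

text \<open>At the vertex \<open>H\<close> the Schreier element is the conjugate of the value of the
  word by \<open>coset_rep H\<close>, an element of \<open>H\<close>; the conjugation disappears in
  the commutative group \<open>M\<close>.\<close>

lemma ev_loop:
  assumes "snd ` set w \<subseteq> {..<k}" and "word_eval G f w \<in> H"
  shows "ev (chain G f H w) = h (word_eval G f w)"
proof -
  let ?t = "coset_rep H" and ?g = "word_eval G f w"
  have t: "?t \<in> H" using coset_rep(1)[OF subgroup_H H_in_rcosets] .
  note i = subgroup.m_inv_closed[OF subgroup_H] and m = subgroup.m_closed[OF subgroup_H]
  have "h (schreier G H ?g) = h ?t \<otimes>\<^bsub>M\<^esub> h ?g \<otimes>\<^bsub>M\<^esub> h (inv ?t)"
    using t assms i m by (simp add: schreier_def translate_H h_mult)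
  also have "\<dots> = h ?g \<otimes>\<^bsub>M\<^esub> (h ?t \<otimes>\<^bsub>M\<^esub> h (inv ?t))"
    using t assms i by (simp add: M.m_ac)
  also have "h ?t \<otimes>\<^bsub>M\<^esub> h (inv ?t) = h \<one>"
    using t i subgroup.mem_carrier[OF subgroup_H t] by (simp add: h_mult[symmetric])
  finally show ?thesis using assms ev_chain[OF assms(1) H_in_rcosets] by simp
qed

lemma ev_span:
  assumes "finite S" and "\<And>p. p \<in> S \<Longrightarrow> ev (c p) = \<one>\<^bsub>M\<^esub>"
  shows "ev (\<lambda>e. \<Sum>p\<in>S. (n p :: int) * c p e) = \<one>\<^bsub>M\<^esub>"
  using assms
proof (induction S rule: finite_induct)
  case (insert p S)
  have nat: "ev (\<lambda>e. int m * c p e) = \<one>\<^bsub>M\<^esub>" for m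
    by (induction m) (use insert.prems in \<open>auto simp: ring_distribs ev_add\<close>)
  have "ev (\<lambda>e. n p * c p e) = \<one>\<^bsub>M\<^esub>"
  proof (cases "n p \<ge> 0")
    case True then show ?thesis using nat[of "nat (n p)"] by simp
  next
    case False
    then have "ev (\<lambda>e. - (n p * c p e)) = \<one>\<^bsub>M\<^esub>" using nat[of "nat (- n p)"] by simp
    then show ?thesis using ev_uminus[of "\<lambda>e. - (n p * c p e)"] by simp
  qed
  then show ?case using insert by (simp add: ev_add)
qed simp

text \<open>A torsion class is represented by a chain that is a rational combination of the relator chains;
  subtracting the integral parts of the coefficients makes its entries bounded.\<close>

lemma torsion_bounded_chain:
  assumes R: "finite R" "\<And>r. r \<in> R \<Longrightarrow> snd ` set r \<subseteq> {..<k}"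
    and gen: "generate G (f ` {..<k}) = carrier G"
    and pres: "\<And>w. snd ` set w \<subseteq> {..<k} \<Longrightarrow> word_eval G f w = \<one> \<longleftrightarrow> pres_equiv R w []"
    and g: "g \<in> H" "n > 0" "g [^] (n::nat) \<in> derived G H"
  shows "\<exists>v. (\<forall>e. \<bar>v e\<bar> \<le> int (\<Sum>r\<in>R. length r)) \<and> ev v = h g"
proof -
  have relator_one: "word_eval G f r = \<one>" if "r \<in> R" for r
    using pres[OF R(2)[OF that]] pres_equiv.relator[OF that, of "[]" "[]"] by simp
  obtain w where w: "snd ` set w \<subseteq> {..<k}" "word_eval G f w = g"
    using exists_word[of g k] gen g(1) subgroup.mem_carrier[OF subgroup_H] by auto
  obtain w' where w': "snd ` set w' \<subseteq> {..<k}" "word_eval G f w' = g [^] n" "chain G f H w' = (\<lambda>e. 0)"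
    using derived_chain_zero[OF gen g(3)] by blast
  \<comment> \<open>Two words for \<open>g [^] n\<close> are compared: \<open>?u\<close> has
    \<open>n\<close> times the chain of \<open>w\<close>, and \<open>w'\<close> has chain zero.
    Their quotient is a consequence of the relators, which makes \<open>n\<close> times the chain of
    \<open>w\<close> an integral boundary.\<close>
  let ?u = "concat (replicate n w)"
  have u: "word_eval G f ?u = g [^] n" "chain G f H ?u e = int n * chain G f H w e" for e
    using word_power[of w n] w g(1) by auto
  have gn: "g [^] n \<in> H" using g(3) derived_incl[OF _ subgroup_H] by blast
  have gnc: "g [^] n \<in> carrier G" using gn subgroup.mem_carrier[OF subgroup_H] by blast
  have "set ?u \<subseteq> set w" by auto
  then have "snd ` set (?u @ word_inv w') \<subseteq> {..<k}" using w(1) w'(1) by (auto simp: image_Un)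
  moreover have "word_eval G f (?u @ word_inv w') = \<one>" using u w' gnc by simp
  ultimately have "pres_equiv R (?u @ word_inv w') []" using pres by blast
  then have "(\<lambda>e. chain G f H (?u @ word_inv w') e) \<in> relator_span R"
    using pres_equiv_chain[OF finite_index R(1) relator_one] H_in_rcosets by fastforce
  moreover have "chain G f H (?u @ word_inv w') e = int n * chain G f H w e" for e
    using chain_word_inv[OF H_in_rcosets, of w' e] w' u gn by (simp add: chain_append H_in_rcosets translate_H)
  ultimately obtain m where m: "\<And>e. int n * chain G f H w e = (\<Sum>p\<in>(rcosets H) \<times> R. m p * chain G f (fst p) (snd p) e)"
    by (auto simp: relator_span_def dest: fun_cong)
  \<comment> \<open>The rational coefficients are \<open>m p / n\<close>, and \<open>q\<close>
    collects their floors. It evaluates to the identity because every relator chain does, so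
    \<open>v\<close> still represents \<open>g\<close>.\<close>
  define q where "q e = (\<Sum>p\<in>(rcosets H) \<times> R. (m p div int n) * chain G f (fst p) (snd p) e)" for e
  define v where "v e = chain G f H w e - q e" for e
  have "\<bar>v e\<bar> \<le> int (\<Sum>r\<in>R. length r)" for e
  proof -
    \<comment> \<open>Multiplying by \<open>n\<close> clears denominators: the coefficients left
      over are the residues \<open>m p mod n\<close>, between 0 and \<open>n\<close>.\<close>
    have "int n * v e = (\<Sum>p\<in>(rcosets H) \<times> R. (m p mod int n) * chain G f (fst p) (snd p) e)"
      by (simp add: v_def q_def right_diff_distrib m sum_distrib_left minus_mult_div_eq_mod[symmetric]
          left_diff_distrib sum_subtractf mult.assoc)
    also have "\<bar>\<dots>\<bar> \<le> (\<Sum>p\<in>(rcosets H) \<times> R. \<bar>(m p mod int n) * chain G f (fst p) (snd p) e\<bar>)"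
      by (rule sum_abs)
    also have "\<dots> \<le> (\<Sum>p\<in>(rcosets H) \<times> R. int n * \<bar>chain G f (fst p) (snd p) e\<bar>)"
    proof (intro sum_mono)
      fix p
      have "0 \<le> m p mod int n" "m p mod int n \<le> int n" using g(2) by (auto intro: less_imp_le)
      then show "\<bar>(m p mod int n) * chain G f (fst p) (snd p) e\<bar> \<le> int n * \<bar>chain G f (fst p) (snd p) e\<bar>"
        by (simp add: abs_mult mult_right_mono)
    qed
    also have "\<dots> = int n * (\<Sum>r\<in>R. \<Sum>C\<in>rcosets H. \<bar>chain G f C r e\<bar>)"
    proof -
      have "(\<Sum>p\<in>(rcosets H) \<times> R. \<bar>chain G f (fst p) (snd p) e\<bar>) = (\<Sum>C\<in>rcosets H. \<Sum>r\<in>R. \<bar>chain G f C r e\<bar>)"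
        by (simp add: sum.cartesian_product split_beta)
      also have "\<dots> = (\<Sum>r\<in>R. \<Sum>C\<in>rcosets H. \<bar>chain G f C r e\<bar>)" by (rule sum.swap)
      finally show ?thesis by (simp add: sum_distrib_left[symmetric])
    qed
    also have "\<dots> \<le> int n * (\<Sum>r\<in>R. int (length r))"
      by (intro mult_left_mono sum_mono sum_abs_chain_le[OF finite_index]) auto
    finally have "int n * \<bar>v e\<bar> \<le> int n * int (\<Sum>r\<in>R. length r)" by (simp add: abs_mult)
    then show ?thesis using g(2) by simp
  qed
  moreover have "ev v = h g"
  proof -
    have "ev q = \<one>\<^bsub>M\<^esub>"
      unfolding q_def using finite_index R relator_one by (intro ev_span) (auto simp: ev_chain schreier_one)
    moreover have "ev v = ev (chain G f H w) \<otimes>\<^bsub>M\<^esub> inv\<^bsub>M\<^esub> ev q"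
      using ev_add[of "chain G f H w" "\<lambda>e. - q e"] ev_uminus[of q] by (simp add: v_def[abs_def])
    ultimately show ?thesis using ev_loop[OF w(1)] w g(1) by simp
  qed
  ultimately show ?thesis by blast
qed

end

section \<open>Counting torsion classes by bounded chains\<close>

lemma (in group) mem_torsion_abelianization_iff:
  "C \<in> torsion (abelianization G) \<longleftrightarrow>
    (\<exists>g n. g \<in> carrier G \<and> n > 0 \<and> g [^] (n::nat) \<in> derived G (carrier G) \<and>
      C = derived G (carrier G) #> g)"
proof -
  let ?D = "derived G (carrier G)"
  interpret D: normal ?D G by (rule derived_is_normal[OF normal_self])
  have pow: "(?D #> g) [^]\<^bsub>G Mod ?D\<^esub> (n::nat) = \<one>\<^bsub>G Mod ?D\<^esub> \<longleftrightarrow> g [^] n \<in> ?D" if g: "g \<in> carrier G" for g n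
  proof -
    have gn: "g [^] n \<in> carrier G" using g by simp
    have "(?D #> g) [^]\<^bsub>G Mod ?D\<^esub> n = ?D #> (g [^] n)" using D.FactGroup_pow[OF g] by simp
    moreover have "?D #> (g [^] n) = ?D \<longleftrightarrow> g [^] n \<in> ?D"
      using coset_join1[OF _ gn D.subgroup_axioms] coset_join2[OF gn D.subgroup_axioms] by blast
    ultimately show ?thesis by simp
  qed
  have "C \<in> torsion (abelianization G) \<longleftrightarrow> (\<exists>g\<in>carrier G. C = ?D #> g \<and>
      (\<exists>n::nat. n > 0 \<and> (?D #> g) [^]\<^bsub>G Mod ?D\<^esub> n = \<one>\<^bsub>G Mod ?D\<^esub>))"
    unfolding torsion_def abelianization_def carrier_FactGroup by blast
  also have "\<dots> \<longleftrightarrow> (\<exists>g\<in>carrier G. C = ?D #> g \<and> (\<exists>n::nat. n > 0 \<and> g [^] n \<in> ?D))"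
    by (rule bex_cong[OF HOL.refl]) (simp only: pow simp_thms)
  finally show ?thesis by blast
qed

text \<open>There are \<open>k\<close> edges per coset, and each coordinate of a bounded chain takes
  one of \<open>2 * l + 1\<close> values, where \<open>l\<close> is the total length of the
  relators; hence the constant \<open>(2 * l + 1) ^ k\<close>.\<close>

lemma finitely_presented_torsion_bound:
  assumes "finitely_presented G"
  shows "\<exists>c::nat. c > 0 \<and> (\<forall>H. subgroup H G \<longrightarrow> finite (rcosets\<^bsub>G\<^esub> H) \<longrightarrow>
      finite (torsion (abelianization (G\<lparr>carrier := H\<rparr>))) \<and>
      card (torsion (abelianization (G\<lparr>carrier := H\<rparr>))) \<le> c ^ card (rcosets\<^bsub>G\<^esub> H))"
proof -
  obtain k f R where G: "group G" and R: "finite R" "\<forall>r\<in>R. snd ` set r \<subseteq> {..<k}"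
    and f: "\<forall>i. f i \<in> carrier G" and gen: "generate G (f ` {..<k}) = carrier G"
    and pres: "\<forall>w. snd ` set w \<subseteq> {..<k} \<longrightarrow> (word_eval G f w = \<one>\<^bsub>G\<^esub> \<longleftrightarrow> pres_equiv R w [])"
    using assms unfolding finitely_presented_def by (elim conjE exE) (rule that)
  interpret group G by fact
  define l where "l = (\<Sum>r\<in>R. length r)"
  have "finite (torsion (abelianization (G\<lparr>carrier := H\<rparr>))) \<and>
      card (torsion (abelianization (G\<lparr>carrier := H\<rparr>))) \<le> ((2 * l + 1) ^ k) ^ card (rcosets\<^bsub>G\<^esub> H)"
    if H: "subgroup H G" "finite (rcosets\<^bsub>G\<^esub> H)" for H
  proof -
    let ?K = "G\<lparr>carrier := H\<rparr>"
    let ?D = "derived ?K (carrier ?K)"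
    interpret K: group ?K using H subgroup_imp_group by blast
    interpret D: normal ?D ?K by (rule K.derived_is_normal[OF K.normal_self])
    interpret M: comm_group "abelianization ?K"
      unfolding abelianization_def by (rule K.derived_quot_is_comm_group)
    have hom: "(\<lambda>g. ?D #>\<^bsub>?K\<^esub> g) \<in> hom ?K (abelianization ?K)"
      unfolding abelianization_def by (rule D.r_coset_hom_Mod)
    interpret HG: subgroup H G by fact
    interpret abelian_cover G f H "abelianization ?K" "\<lambda>g. ?D #>\<^bsub>?K\<^esub> g" k
      using f H hom by unfold_locales simp_all
    let ?V = "((rcosets\<^bsub>G\<^esub> H) \<times> {..<k}) \<rightarrow>\<^sub>E {- int l..int l}"
    have sub: "torsion (abelianization ?K) \<subseteq> ev ` ?V"
    proof
      fix x assume "x \<in> torsion (abelianization ?K)"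
      then obtain g n where g: "g \<in> H" "x = ?D #>\<^bsub>?K\<^esub> g" and n: "n > 0" "g [^]\<^bsub>?K\<^esub> (n::nat) \<in> ?D"
        unfolding K.mem_torsion_abelianization_iff by auto
      then have "g [^]\<^bsub>G\<^esub> n \<in> derived G H"
        using derived_consistent[OF _ H(1)] by (simp add: nat_pow_consistent[symmetric])
      then obtain v where v: "\<And>e. \<bar>v e\<bar> \<le> int l" "ev v = x"
        using torsion_bounded_chain[OF R(1) _ gen _ g(1) n(1)] R(2) pres g(2) unfolding l_def by auto
      \<comment> \<open>\<open>ev\<close> reads only the coordinates at edges with index below
        \<open>k\<close>, so the chain can be cut down to one of finitely many functions.\<close>
      have "ev (restrict v ((rcosets\<^bsub>G\<^esub> H) \<times> {..<k})) = x"
        using ev_cong[of "restrict v ((rcosets\<^bsub>G\<^esub> H) \<times> {..<k})" v] v(2) by simp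
      moreover have "restrict v ((rcosets\<^bsub>G\<^esub> H) \<times> {..<k}) \<in> ?V"
        using v(1) by (auto simp: abs_le_iff minus_le_iff)
      ultimately show "x \<in> ev ` ?V" by blast
    qed
    have fin: "finite ?V" using H(2) by (intro finite_PiE) auto
    have "card (torsion (abelianization ?K)) \<le> card (ev ` ?V)"
      using sub fin by (intro card_mono) auto
    also have "\<dots> \<le> card ?V" using fin by (rule card_image_le)
    also have "card ?V = (2 * l + 1) ^ (k * card (rcosets\<^bsub>G\<^esub> H))"
    proof -
      have "card {- int l..int l} = 2 * l + 1" by simp
      then show ?thesis
        using H(2) by (subst card_PiE) (auto simp: card_cartesian_product mult.commute[of k])
    qed
    also have "\<dots> = ((2 * l + 1) ^ k) ^ card (rcosets\<^bsub>G\<^esub> H)" by (rule power_mult)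
    finally show "finite (torsion (abelianization ?K)) \<and>
      card (torsion (abelianization ?K)) \<le> ((2 * l + 1) ^ k) ^ card (rcosets\<^bsub>G\<^esub> H)"
      using sub fin finite_subset by blast
  qed
  then show ?thesis by (intro exI[of _ "(2 * l + 1) ^ k"]) simp
qed

section \<open>Derived groups of central extensions of finite groups\<close>

context group
begin

lemma commute_generate:
  assumes "Y \<subseteq> carrier G" and u: "u \<in> carrier G" and "\<And>y. y \<in> Y \<Longrightarrow> y \<otimes> u = u \<otimes> y"
    and g: "g \<in> generate G Y"
  shows "g \<otimes> u = u \<otimes> g"
  using g
proof (induction rule: generate.induct)
  case one then show ?case using u by simp
next
  case (incl y) then show ?case using assms by simp
next
  case (inv y)
  then have y: "y \<in> carrier G" "y \<otimes> u = u \<otimes> y" using assms by auto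
  have "inv y \<otimes> u = inv y \<otimes> (u \<otimes> y) \<otimes> inv y" using y(1) u by (simp add: m_assoc)
  also have "\<dots> = u \<otimes> inv y" using y u by (simp add: y(2)[symmetric] m_assoc)
  finally show ?case .
next
  case (eng a b)
  then have ab: "a \<in> carrier G" "b \<in> carrier G" using generate_in_carrier[OF assms(1)] by auto
  have "a \<otimes> b \<otimes> u = a \<otimes> (u \<otimes> b)" using ab u eng by (simp add: m_assoc)
  also have "\<dots> = a \<otimes> u \<otimes> b" using ab u by (simp add: m_assoc)
  also have "\<dots> = u \<otimes> a \<otimes> b" using eng by simp
  finally show ?case using ab u by (simp add: m_assoc)
qed

text \<open>Conjugation by \<open>inv y\<close> is a separate hypothesis: for infinite
  \<open>V\<close>, being mapped into itself by \<open>y\<close> does not give the same for the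
  inverse.\<close>

lemma conj_generate:
  assumes "Y \<subseteq> carrier G" and "V \<subseteq> carrier G"
    and "\<And>y v. y \<in> Y \<Longrightarrow> v \<in> V \<Longrightarrow> y \<otimes> v \<otimes> inv y \<in> V"
    and "\<And>y v. y \<in> Y \<Longrightarrow> v \<in> V \<Longrightarrow> inv y \<otimes> v \<otimes> y \<in> V"
    and g: "g \<in> generate G Y" and v: "v \<in> V"
  shows "g \<otimes> v \<otimes> inv g \<in> V"
  using g v
proof (induction arbitrary: v rule: generate.induct)
  case one then show ?case using assms(2) by auto
next
  case (incl y) then show ?case using assms by simp
next
  case (inv y)
  then have "inv (inv y) = y" using assms(1) by auto
  then show ?case using assms(4)[OF inv(1,2)] by simp
next
  case (eng a b)
  have c: "a \<in> carrier G" "b \<in> carrier G" "v \<in> carrier G"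
    using eng generate_in_carrier[OF assms(1)] assms(2) by auto
  have "a \<otimes> (b \<otimes> v \<otimes> inv b) \<otimes> inv a \<in> V" using eng by blast
  then show ?case using c by (simp add: m_assoc inv_mult_group)
qed

text \<open>In \<open>G Mod T\<close> the images of the generators commute with each other, so the
  quotient is abelian and the derived group dies in it.\<close>

lemma derived_subset_of_commuting_generators:
  assumes T: "T \<lhd> G" and Y: "Y \<subseteq> carrier G" "generate G Y = carrier G"
    and comm: "\<And>y z. y \<in> Y \<Longrightarrow> z \<in> Y \<Longrightarrow> y \<otimes> z \<otimes> inv y \<otimes> inv z \<in> T"
  shows "derived G (carrier G) \<subseteq> T"
proof
  interpret T: normal T G by fact
  interpret Q: group "G Mod T" by (rule T.factorgroup_is_group)
  let ?p = "\<lambda>g. T #> g"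
  have p: "?p \<in> hom G (G Mod T)" by (rule T.r_coset_hom_Mod)
  interpret p: group_hom G "G Mod T" ?p using p by unfold_locales
  have pY: "?p y \<otimes>\<^bsub>G Mod T\<^esub> ?p z = ?p z \<otimes>\<^bsub>G Mod T\<^esub> ?p y" if "y \<in> Y" "z \<in> Y" for y z
  proof -
    have yz: "y \<in> carrier G" "z \<in> carrier G" using that Y by auto
    have "y \<otimes> z = (y \<otimes> z \<otimes> inv y \<otimes> inv z) \<otimes> (z \<otimes> y)"
      using yz by (simp add: m_assoc)
    then have "y \<otimes> z \<in> T #> (z \<otimes> y)" using comm[OF that] unfolding r_coset_def by blast
    then have "?p (y \<otimes> z) = ?p (z \<otimes> y)"
      using repr_independence[OF _ _ T.subgroup_axioms] yz by (metis m_closed)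
    then show ?thesis using yz p.hom_mult by metis
  qed
  have gen: "generate (G Mod T) (?p ` Y) = carrier (G Mod T)"
    using p.generate_img[OF Y(1)] Y(2) by (simp add: carrier_FactGroup)
  have sub: "?p ` Y \<subseteq> carrier (G Mod T)" using Y(1) by (auto simp: carrier_FactGroup)
  \<comment> \<open>Commutation is extended one argument at a time: first every element against a
    generator, then against every element.\<close>
  have 1: "a \<otimes>\<^bsub>G Mod T\<^esub> b = b \<otimes>\<^bsub>G Mod T\<^esub> a" if "a \<in> carrier (G Mod T)" "b \<in> ?p ` Y" for a b
  proof (rule Q.commute_generate[OF sub])
    show "b \<in> carrier (G Mod T)" using that sub by blast
    show "a \<in> generate (G Mod T) (?p ` Y)" using that gen by simp
    show "y \<otimes>\<^bsub>G Mod T\<^esub> b = b \<otimes>\<^bsub>G Mod T\<^esub> y" if "y \<in> ?p ` Y" for y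
      using \<open>b \<in> ?p ` Y\<close> that pY by blast
  qed
  have "a \<otimes>\<^bsub>G Mod T\<^esub> b = b \<otimes>\<^bsub>G Mod T\<^esub> a" if "a \<in> carrier (G Mod T)" "b \<in> carrier (G Mod T)" for a b
  proof (rule Q.commute_generate[OF sub])
    show "b \<in> carrier (G Mod T)" using that by blast
    show "a \<in> generate (G Mod T) (?p ` Y)" using that gen by simp
    show "y \<otimes>\<^bsub>G Mod T\<^esub> b = b \<otimes>\<^bsub>G Mod T\<^esub> y" if "y \<in> ?p ` Y" for y
      using 1[OF \<open>b \<in> carrier (G Mod T)\<close> that] by simp
  qed
  then have "comm_group (G Mod T)" by (rule Q.group_comm_groupI)
  then have "?p g = T" if "g \<in> derived G (carrier G)" for g
    using hom_derived_eq_one[OF _ p that] by simp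
  moreover have "derived G (carrier G) \<subseteq> carrier G" using derived_in_carrier by simp
  ultimately show "g \<in> T" if "g \<in> derived G (carrier G)" for g
    using that coset_join1[OF _ _ T.subgroup_axioms] by blast
qed

text \<open>The map \<open>a \<mapsto> [a, x]\<close> is an endomorphism of the abelian group \<open>A\<close>, so its image is already a
  subgroup.\<close>

lemma derived_subset_commutators:
  assumes A: "A \<lhd> G" and abelian: "\<And>a b. a \<in> A \<Longrightarrow> b \<in> A \<Longrightarrow> a \<otimes> b = b \<otimes> a"
    and x: "x \<in> carrier G" and gen: "generate G (insert x A) = carrier G"
  shows "derived G (carrier G) \<subseteq> (\<lambda>a. a \<otimes> x \<otimes> inv a \<otimes> inv x) ` A"
proof -
  interpret A: normal A G by fact
  define c where "c a = a \<otimes> x \<otimes> inv a \<otimes> inv x" for a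
  have cA: "c a \<in> A" if "a \<in> A" for a
  proof -
    have "x \<otimes> inv a \<otimes> inv x \<in> A" using A.inv_op_closed2[OF x, of "inv a"] that by simp
    then have "a \<otimes> (x \<otimes> inv a \<otimes> inv x) \<in> A" using that by simp
    then show ?thesis using that x A.mem_carrier by (simp add: c_def m_assoc)
  qed
  have c_mult: "c (a \<otimes> b) = c a \<otimes> c b" if "a \<in> A" "b \<in> A" for a b
  proof -
    have ab: "a \<in> carrier G" "b \<in> carrier G" using that A.mem_carrier by auto
    have "c (a \<otimes> b) = (a \<otimes> c b) \<otimes> (x \<otimes> inv a \<otimes> inv x)"
      using ab x by (simp add: c_def m_assoc inv_mult_group)
    also have "a \<otimes> c b = c b \<otimes> a" by (rule abelian[OF that(1) cA[OF that(2)]])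
    also have "c b \<otimes> a \<otimes> (x \<otimes> inv a \<otimes> inv x) = c b \<otimes> c a"
      using ab x by (simp add: c_def m_assoc)
    also have "\<dots> = c a \<otimes> c b" by (rule abelian[OF cA[OF that(2)] cA[OF that(1)]])
    finally show ?thesis .
  qed
  have c_inv: "inv (c a) = c (inv a)" if "a \<in> A" for a
  proof -
    have "c (inv a) \<otimes> c a = c (inv a \<otimes> a)"
      by (rule c_mult[OF A.m_inv_closed[OF that] that, symmetric])
    also have "\<dots> = \<one>" using x A.mem_carrier[OF that] by (simp add: c_def)
    finally show ?thesis
      using inv_equality A.mem_carrier[OF cA[OF that]] A.mem_carrier[OF cA[OF A.m_inv_closed[OF that]]] by blast
  qed
  have sub: "subgroup (c ` A) G"
  proof (rule subgroupI)
    show "c ` A \<subseteq> carrier G" by (intro image_subsetI A.mem_carrier cA)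
    show "c ` A \<noteq> {}" using imageI[OF A.one_closed, of c] by (metis empty_iff)
    fix t assume "t \<in> c ` A"
    then obtain b where b: "b \<in> A" "t = c b" by blast
    show "inv t \<in> c ` A" unfolding b(2) c_inv[OF b(1)] by (intro imageI A.m_inv_closed b(1))
    fix s assume "s \<in> c ` A"
    then obtain a where a: "a \<in> A" "s = c a" by blast
    show "s \<otimes> t \<in> c ` A"
      unfolding a(2) b(2) c_mult[OF a(1) b(1), symmetric] by (intro imageI A.m_closed a(1) b(1))
  qed
  have xa: "insert x A \<subseteq> carrier G" using x A.subset by auto
  have conj_a: "a \<otimes> t \<otimes> inv a = t" if "a \<in> A" "t \<in> A" for a t
  proof -
    have "a \<otimes> t \<otimes> inv a = t \<otimes> a \<otimes> inv a" using abelian[OF that] by (rule arg_cong)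
    then show ?thesis using that A.mem_carrier by (simp add: m_assoc)
  qed
  have conj_x: "x \<otimes> c a \<otimes> inv x = c (x \<otimes> a \<otimes> inv x)" "inv x \<otimes> c a \<otimes> x = c (inv x \<otimes> a \<otimes> x)" if "a \<in> A" for a
    using that x A.mem_carrier by (simp_all add: c_def m_assoc inv_mult_group)
  have conj: "g \<otimes> t \<otimes> inv g \<in> c ` A" if g: "g \<in> carrier G" and t: "t \<in> c ` A" for g t
  proof (rule conj_generate[OF xa _ _ _ _ t])
    show "c ` A \<subseteq> carrier G" by (intro image_subsetI A.mem_carrier cA)
    show "g \<in> generate G (insert x A)" using g gen by simp
    fix y s assume ys: "y \<in> insert x A" "s \<in> c ` A"
    then obtain a where a: "a \<in> A" "s = c a" by blast
    show "y \<otimes> s \<otimes> inv y \<in> c ` A"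
    proof (cases "y = x")
      case True
      then show ?thesis using a conj_x(1)[OF a(1)] A.inv_op_closed2[OF x a(1)] by simp
    next
      case False
      then show ?thesis using ys a conj_a[of y s] cA by simp
    qed
    show "inv y \<otimes> s \<otimes> y \<in> c ` A"
    proof (cases "y = x")
      case True
      then show ?thesis using a conj_x(2)[OF a(1)] A.inv_op_closed1[OF x a(1)] by simp
    next
      case False
      then have "y \<in> A" using ys by simp
      then show ?thesis using ys a conj_a[of "inv y" s] cA A.mem_carrier[of y] by simp
    qed
  qed
  have normal: "c ` A \<lhd> G" using sub conj by (simp add: normal_inv_iff)
  \<comment> \<open>Only commutators of generators need checking: elements of \<open>A\<close>
    commute with each other, [a, x] is \<open>c a\<close>, and [x, a] is its inverse, again a value
    of \<open>c\<close> by \<open>c_inv\<close>.\<close>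
  have "derived G (carrier G) \<subseteq> c ` A"
  proof (rule derived_subset_of_commuting_generators[OF normal xa gen])
    fix y z assume yz: "y \<in> insert x A" "z \<in> insert x A"
    have one: "\<one> \<in> c ` A" using subgroup.one_closed[OF sub] .
    consider "y \<in> A" "z \<in> A" | "y \<in> A" "z = x" | "y = x" "z \<in> A" | "y = x" "z = x" using yz by blast
    then show "y \<otimes> z \<otimes> inv y \<otimes> inv z \<in> c ` A"
    proof cases
      case 1
      then show ?thesis using conj_a[OF 1] A.mem_carrier one by simp
    next
      case 2
      then show ?thesis using imageI[of y A c] by (simp add: c_def)
    next
      case 3
      have "y \<otimes> z \<otimes> inv y \<otimes> inv z = inv (c z)"
        using 3 x A.mem_carrier by (simp add: c_def m_assoc inv_mult_group)
      then show ?thesis using imageI[OF A.m_inv_closed[OF 3(2)], of c] c_inv[OF 3(2)] by simp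
    next
      case 4
      then show ?thesis using x one by (simp add: m_assoc)
    qed
  qed
  then show ?thesis by (simp add: c_def[abs_def])
qed

text \<open>Modulo \<open>derived G W\<close> the subgroup \<open>W\<close> becomes abelian, so by
  \<open>derived_subset_commutators\<close> the derived group there consists of single commutators
  with \<open>x\<close>. The label \<open>q w\<close> determines such a commutator already in
  \<open>G\<close>, so at most \<open>card V\<close> of them occur.\<close>

lemma card_derived_cyclic_extension:
  assumes W: "W \<lhd> G" and x: "x \<in> carrier G" and gen: "generate G (insert x W) = carrier G"
    and fin: "finite (derived G W)" "finite V" and q: "q ` W \<subseteq> V"
    and dep: "\<And>v w. v \<in> W \<Longrightarrow> w \<in> W \<Longrightarrow> q v = q w \<Longrightarrow>
      v \<otimes> x \<otimes> inv v \<otimes> inv x = w \<otimes> x \<otimes> inv w \<otimes> inv x"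
  shows "finite (derived G (carrier G)) \<and> card (derived G (carrier G)) \<le> card V * card (derived G W)"
proof -
  interpret W: normal W G by fact
  let ?D = "derived G W" let ?c = "\<lambda>a. a \<otimes> x \<otimes> inv a \<otimes> inv x"
  interpret D: normal ?D G by (rule derived_is_normal[OF W])
  let ?M = "G Mod ?D" let ?p = "\<lambda>g. ?D #> g"
  interpret M: group ?M by (rule D.factorgroup_is_group)
  interpret p: group_hom G ?M ?p using D.r_coset_hom_Mod by unfold_locales
  have surj: "?p ` carrier G = carrier ?M" by (simp add: carrier_FactGroup)
  have pW: "?p ` W \<lhd> ?M" by (rule W.surj_hom_normal_subgroup[OF p.group_hom_axioms surj])
  have abelian: "a \<otimes>\<^bsub>?M\<^esub> b = b \<otimes>\<^bsub>?M\<^esub> a" if ab: "a \<in> ?p ` W" "b \<in> ?p ` W" for a b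
  proof -
    obtain v w where vw: "v \<in> W" "w \<in> W" "a = ?p v" "b = ?p w" using ab by blast
    have c: "v \<in> carrier G" "w \<in> carrier G" using vw W.mem_carrier by auto
    have "v \<otimes> w \<otimes> inv v \<otimes> inv w \<in> ?D"
      using vw unfolding derived_def by (intro generate.incl) blast
    moreover have "v \<otimes> w = (v \<otimes> w \<otimes> inv v \<otimes> inv w) \<otimes> (w \<otimes> v)"
      using c by (simp add: m_assoc)
    ultimately have "v \<otimes> w \<in> ?D #> (w \<otimes> v)" unfolding r_coset_def by blast
    then have "?p (v \<otimes> w) = ?p (w \<otimes> v)"
      using repr_independence[OF _ _ D.subgroup_axioms] c by (metis m_closed)
    then show ?thesis using c vw p.hom_mult by metis
  qed
  have "generate ?M (?p ` insert x W) = carrier ?M"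
    using p.generate_img[of "insert x W"] gen x W.subset surj by simp
  then have dM: "derived ?M (carrier ?M) \<subseteq> (\<lambda>a. a \<otimes>\<^bsub>?M\<^esub> ?p x \<otimes>\<^bsub>?M\<^esub> inv\<^bsub>?M\<^esub> a \<otimes>\<^bsub>?M\<^esub> inv\<^bsub>?M\<^esub> ?p x) ` (?p ` W)"
    using x surj by (intro M.derived_subset_commutators[OF pW abelian]) auto
  have sub: "derived G (carrier G) \<subseteq> (\<lambda>(d, t). d \<otimes> t) ` (?D \<times> ?c ` W)"
  proof
    fix g assume g: "g \<in> derived G (carrier G)"
    then have gc: "g \<in> carrier G" using derived_in_carrier by blast
    have "?p g \<in> derived ?M (carrier ?M)" using g p.derived_img[of "carrier G"] surj by auto
    then obtain w where w: "w \<in> W" "?p g = ?p w \<otimes>\<^bsub>?M\<^esub> ?p x \<otimes>\<^bsub>?M\<^esub> inv\<^bsub>?M\<^esub> ?p w \<otimes>\<^bsub>?M\<^esub> inv\<^bsub>?M\<^esub> ?p x"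
      using dM by blast
    have "?p (?c w) = ?p w \<otimes>\<^bsub>?M\<^esub> ?p x \<otimes>\<^bsub>?M\<^esub> inv\<^bsub>?M\<^esub> ?p w \<otimes>\<^bsub>?M\<^esub> inv\<^bsub>?M\<^esub> ?p x"
      using x W.mem_carrier[OF w(1)] by (simp del: mult_FactGroup)
    then have "?p g = ?p (?c w)" using w(2) by simp
    then have "g \<in> ?D #> ?c w" using rcos_self[OF gc D.subgroup_axioms] by simp
    then obtain d where "d \<in> ?D" "g = d \<otimes> ?c w" unfolding r_coset_def by blast
    then show "g \<in> (\<lambda>(d, t). d \<otimes> t) ` (?D \<times> ?c ` W)"
      using w(1) by (intro image_eqI[of _ _ "(d, ?c w)"]) simp_all
  qed
  \<comment> \<open>\<open>r\<close> lists the commutators by label; a label carried by no element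
    of \<open>W\<close> contributes an arbitrary value, harmless for an upper bound.\<close>
  define r where "r y = ?c (SOME v. v \<in> W \<and> q v = y)" for y
  have r: "?c w = r (q w)" if w: "w \<in> W" for w
  proof -
    have v: "(SOME v. v \<in> W \<and> q v = q w) \<in> W \<and> q (SOME v. v \<in> W \<and> q v = q w) = q w"
      by (rule someI[of _ w]) (use w in simp)
    show ?thesis unfolding r_def by (rule dep[OF w conjunct1[OF v] conjunct2[OF v, symmetric]])
  qed
  have cV: "?c ` W \<subseteq> r ` V"
  proof (rule image_subsetI)
    fix w assume w: "w \<in> W"
    show "?c w \<in> r ` V" unfolding r[OF w] using q w by (intro imageI) blast
  qed
  have finc: "finite (?c ` W)" using cV fin(2) finite_subset by blast
  have "card (?c ` W) \<le> card (r ` V)" using cV fin(2) by (intro card_mono) auto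
  also have "\<dots> \<le> card V" using fin(2) by (rule card_image_le)
  finally have cc: "card (?c ` W) \<le> card V" .
  have "card (derived G (carrier G)) \<le> card ((\<lambda>(d, t). d \<otimes> t) ` (?D \<times> ?c ` W))"
    using sub fin finc by (intro card_mono) simp_all
  also have "\<dots> \<le> card (?D \<times> ?c ` W)" using fin finc by (intro card_image_le) simp
  also have "\<dots> \<le> card V * card ?D" using cc by (simp add: card_cartesian_product mult.commute)
  finally show ?thesis using finite_subset[OF sub] fin finc by simp
qed

text \<open>\<open>V\<close> acts on its cosets by translation; the coset \<open>V\<close> is fixed, and the number of fixed cosets is
  divisible by \<open>p\<close>. A second fixed coset consists of elements normalizing \<open>V\<close>.\<close>

lemma prime_power_order_normalizer_grows:
  assumes p: "Factorial_Ring.prime (p::nat)" and ord: "Coset.order G = p ^ n" and V: "subgroup V G" "V \<noteq> carrier G"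
  shows "\<exists>x\<in>carrier G - V. \<forall>v\<in>V. x \<otimes> v \<otimes> inv x \<in> V"
proof (rule ccontr)
  assume contra: "\<not> ?thesis"
  interpret V: subgroup V G by fact
  let ?K = "G\<lparr>carrier := V\<rparr>" and ?E = "rcosets V"
  interpret K: group ?K by (rule subgroup_imp_group[OF V(1)])
  have finG: "finite (carrier G)"
    using ord p by (metis order_gt_0_iff_finite prime_gt_0_nat zero_less_power)
  have finE: "finite ?E" using finG by (simp add: RCOSETS_def)
  have finV: "finite V" using finG V.subset finite_subset by blast
  \<comment> \<open>Right translation by the inverse is a left action, as composition in
    \<open>BijGroup\<close> requires.\<close>
  define \<phi> where "\<phi> v = (\<lambda>C\<in>?E. C #> inv v)" for v
  have bij: "bij_betw (\<phi> v) ?E ?E" if "v \<in> V" for v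
  proof -
    have "bij_betw (\<lambda>C. C #> inv v) ?E ?E"
      using that by (intro bij_betw_rcosets_translate[OF V(1)]) simp
    then show ?thesis unfolding \<phi>_def by simp
  qed
  have "\<phi> \<in> hom ?K (BijGroup ?E)"
  proof (rule homI)
    show 1: "\<phi> v \<in> carrier (BijGroup ?E)" if "v \<in> carrier ?K" for v
      using bij that by (auto simp: BijGroup_def Bij_def \<phi>_def)
    fix v w assume vw: "v \<in> carrier ?K" "w \<in> carrier ?K"
    have "\<phi> (v \<otimes> w) = compose ?E (\<phi> v) (\<phi> w)"
      using vw rcosets_translate[OF V(1)] rcosets_translate_mult[OF V(1)]
      by (auto simp: \<phi>_def compose_def inv_mult_group fun_eq_iff)
    then show "\<phi> (v \<otimes>\<^bsub>?K\<^esub> w) = \<phi> v \<otimes>\<^bsub>BijGroup ?E\<^esub> \<phi> w"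
      using 1 vw by (simp add: BijGroup_def)
  qed
  then interpret group_action ?K ?E \<phi>
    by (intro group_action.intro group_hom.intro group_hom_axioms.intro K.is_group group_BijGroup)
  have V_coset: "V \<in> ?E" by (rule V.subgroup_in_rcosets[OF is_group])
  have orbit_V: "orbit ?K \<phi> V = {V}"
  proof -
    have "\<phi> v V = V" if "v \<in> V" for v
      using that V_coset coset_join2[OF _ V(1), of "inv v"] by (simp add: \<phi>_def)
    moreover from this[OF V.one_closed] have "\<exists>g. V = \<phi> g V \<and> g \<in> V" using V.one_closed by metis
    ultimately show ?thesis by (auto simp: orbit_def)
  qed
  have index: "card ?E * card V = p ^ n" using lagrange[OF V(1)] ord by simp
  then have cardV: "card V dvd p ^ n" using dvd_triv_right[of "card V" "card ?E"] by simp
  \<comment> \<open>Orbit sizes are powers of \<open>p\<close>. A one-point orbit other than that of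
    \<open>V\<close> is a coset of some \<open>g\<close> outside \<open>V\<close> that conjugates
    \<open>V\<close> into itself, which \<open>contra\<close> excludes.\<close>
  have big: "p dvd card (orbit ?K \<phi> C)" if C: "C \<in> ?E" "C \<noteq> V" for C
  proof -
    have "card (orbit ?K \<phi> C) * card (stabilizer ?K \<phi> C) = card V"
      using orbit_stabilizer_theorem[OF C(1)] by (simp add: Coset.order_def)
    then have "card (orbit ?K \<phi> C) dvd card V"
      using dvd_triv_left[of "card (orbit ?K \<phi> C)" "card (stabilizer ?K \<phi> C)"] by simp
    from dvd_trans[OF this cardV] obtain i where i: "card (orbit ?K \<phi> C) = p ^ i"
      using divides_primepow_nat[OF p] by blast
    have "i \<noteq> 0"
    proof
      assume "i = 0"
      then have "card (orbit ?K \<phi> C) = 1" using i by simp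
      then obtain y where y: "orbit ?K \<phi> C = {y}" by (rule card_1_singletonE)
      have fixed: "C #> v = C" if v: "v \<in> V" for v
      proof -
        have "inv v \<in> carrier ?K" using v by simp
        then have "\<phi> (inv v) C \<in> orbit ?K \<phi> C" unfolding orbit_def by blast
        then have "\<phi> (inv v) C = C" using orbit_refl[OF C(1)] y by simp
        then show ?thesis using C(1) v by (simp add: \<phi>_def)
      qed
      obtain g where g: "g \<in> carrier G" "C = V #> g" using C(1) by (auto simp: RCOSETS_def)
      have "g \<notin> V" using C(2) g coset_join2[OF g(1) V(1)] by blast
      moreover have "g \<otimes> v \<otimes> inv g \<in> V" if v: "v \<in> V" for v
      proof -
        have "V #> (g \<otimes> v) = V #> g" using fixed[OF v] g v coset_mult_assoc[OF V.subset g(1), of v] by simp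
        then have "g \<otimes> v \<in> V #> g" using rcos_self[OF _ V(1), of "g \<otimes> v"] g v by simp
        then show ?thesis using V.rcos_module_imp[OF is_group g(1)] by simp
      qed
      ultimately show False using contra g(1) by blast
    qed
    then show ?thesis using i by simp
  qed
  have "p dvd card (\<Union> (orbits ?K ?E \<phi> - {{V}}))"
  proof (rule dvd_partition)
    show "\<forall>c\<in>orbits ?K ?E \<phi> - {{V}}. p dvd card c"
    proof
      fix c assume c: "c \<in> orbits ?K ?E \<phi> - {{V}}"
      then obtain C where C: "C \<in> ?E" "c = orbit ?K \<phi> C" unfolding orbits_def by blast
      then have "C \<noteq> V" using c orbit_V by blast
      then show "p dvd card c" using big C by simp
    qed
    show "\<forall>c1\<in>orbits ?K ?E \<phi> - {{V}}. \<forall>c2\<in>orbits ?K ?E \<phi> - {{V}}. c1 \<noteq> c2 \<longrightarrow> c1 \<inter> c2 = {}"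
    proof (intro ballI impI)
      fix c d assume "c \<in> orbits ?K ?E \<phi> - {{V}}" "d \<in> orbits ?K ?E \<phi> - {{V}}" "c \<noteq> d"
      then show "c \<inter> d = {}" using disjoint_union[of c d] by simp
    qed
    show "finite (\<Union> (orbits ?K ?E \<phi> - {{V}}))"
      by (rule finite_subset[OF Union_mono[OF Diff_subset]]) (simp add: orbits_coverture finE)
  qed
  also have "\<Union> (orbits ?K ?E \<phi> - {{V}}) = ?E - {V}"
  proof -
    have VV: "{V} \<in> orbits ?K ?E \<phi>" using orbit_V V_coset unfolding orbits_def by blast
    show ?thesis
    proof (intro equalityI subsetI)
      fix C assume "C \<in> \<Union> (orbits ?K ?E \<phi> - {{V}})"
      then obtain c where c: "c \<in> orbits ?K ?E \<phi>" "c \<noteq> {V}" "C \<in> c" by blast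
      have "C \<in> ?E" using c(1,3) orbits_coverture by blast
      moreover have "C \<noteq> V" using disjoint_union[OF VV c(1)] c(2,3) by blast
      ultimately show "C \<in> ?E - {V}" by simp
    next
      fix C assume C: "C \<in> ?E - {V}"
      then have "C \<in> \<Union> (orbits ?K ?E \<phi>)" using orbits_coverture by simp
      then show "C \<in> \<Union> (orbits ?K ?E \<phi> - {{V}})" using C by blast
    qed
  qed
  also have "card (?E - {V}) = card ?E - 1" using V_coset finE by simp
  finally have 1: "p dvd card ?E - 1" .
  \<comment> \<open>Since \<open>V\<close> is proper, its index is a positive power of
    \<open>p\<close>, so \<open>p\<close> would divide two consecutive numbers.\<close>
  have "card ?E dvd p ^ n" using index dvd_triv_left[of "card ?E" "card V"] by simp
  then obtain j where j: "card ?E = p ^ j" using divides_primepow_nat[OF p] by blast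
  have "j \<noteq> 0"
  proof
    assume "j = 0"
    then have "card V = card (carrier G)" using lagrange[OF V(1)] j by (simp add: Coset.order_def)
    then show False using card_subset_eq[OF finG V.subset] V(2) by simp
  qed
  then have "p dvd card ?E" using j by simp
  moreover have "card ?E > 0" using j p by (simp add: prime_gt_0_nat)
  ultimately have "p dvd 1" using 1 dvd_diff_nat[of p "card ?E" "card ?E - 1"] by simp
  then show False using p by simp
qed

text \<open>An injective self-map of a finite set is onto. This supplies the inverse half of the
  hypotheses of \<open>conj_generate\<close>.\<close>

lemma conj_inv_mem_of_finite:
  assumes "finite V" and "V \<subseteq> carrier G" and x: "x \<in> carrier G"
    and conj: "\<And>v. v \<in> V \<Longrightarrow> x \<otimes> v \<otimes> inv x \<in> V" and v: "v \<in> V"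
  shows "inv x \<otimes> v \<otimes> x \<in> V"
proof -
  have "inj_on (\<lambda>v. x \<otimes> v \<otimes> inv x) V"
    using assms(2) x by (intro inj_onI) (metis inv_closed l_cancel m_closed r_cancel subsetD)
  moreover have "(\<lambda>v. x \<otimes> v \<otimes> inv x) ` V \<subseteq> V" by (intro image_subsetI conj)
  ultimately have "(\<lambda>v. x \<otimes> v \<otimes> inv x) ` V = V" by (simp add: endo_inj_surj assms(1))
  then obtain u where u: "u \<in> V" "v = x \<otimes> u \<otimes> inv x" using v by blast
  then have "inv x \<otimes> v \<otimes> x = u" using x assms(2) by (auto simp: m_assoc subset_iff)
  then show ?thesis using u by simp
qed

end

section \<open>Derived groups of preimages under a homomorphism with central kernel\<close>

context group_hom
begin

lemma subgroup_preimage: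
  assumes "subgroup V H"
  shows "subgroup {g \<in> carrier G. h g \<in> V} G"
proof (rule G.subgroupI)
  interpret V: subgroup V H by fact
  show "{g \<in> carrier G. h g \<in> V} \<noteq> {}" using V.one_closed by auto
qed (use assms in \<open>auto intro: subgroup.m_closed subgroup.m_inv_closed\<close>)

lemma derived_kernel_central:
  assumes central: "\<And>z g. z \<in> carrier G \<Longrightarrow> h z = \<one>\<^bsub>H\<^esub> \<Longrightarrow> g \<in> carrier G \<Longrightarrow> z \<otimes> g = g \<otimes> z"
  shows "derived G {g \<in> carrier G. h g \<in> {\<one>\<^bsub>H\<^esub>}} = {\<one>}"
proof
  let ?Z = "{g \<in> carrier G. h g \<in> {\<one>\<^bsub>H\<^esub>}}"
  have "derived_set G ?Z \<subseteq> {\<one>}"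
  proof
    fix g assume "g \<in> derived_set G ?Z"
    then obtain a b where ab: "a \<in> carrier G" "h a = \<one>\<^bsub>H\<^esub>" "b \<in> carrier G" "g = a \<otimes> b \<otimes> inv a \<otimes> inv b" by auto
    have "a \<otimes> b = b \<otimes> a" using central[OF ab(1,2,3)] .
    then show "g \<in> {\<one>}" using ab by (simp add: G.m_assoc)
  qed
  then show "derived G ?Z \<subseteq> {\<one>}"
    unfolding derived_def using G.generate_subgroup_incl G.triv_subgroup by blast
  show "{\<one>} \<subseteq> derived G ?Z" unfolding derived_def using generate.one by blast
qed

text \<open>An instance of \<open>card_derived_cyclic_extension\<close>, with a lift
  \<open>y\<close> of \<open>x\<close> as the new generator and \<open>h\<close> as the label: two
  elements with the same image differ by a central one, so they have the same commutator with
  \<open>y\<close>.\<close>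

lemma card_derived_preimage_extension:
  assumes surj: "h ` carrier G = carrier H"
    and central: "\<And>z g. z \<in> carrier G \<Longrightarrow> h z = \<one>\<^bsub>H\<^esub> \<Longrightarrow> g \<in> carrier G \<Longrightarrow> z \<otimes> g = g \<otimes> z"
    and V: "subgroup V H" "finite V" and x: "x \<in> carrier H"
    and conj: "\<And>v. v \<in> V \<Longrightarrow> x \<otimes>\<^bsub>H\<^esub> v \<otimes>\<^bsub>H\<^esub> inv\<^bsub>H\<^esub> x \<in> V"
    and fin: "finite (derived G {g \<in> carrier G. h g \<in> V})"
  shows "finite (derived G {g \<in> carrier G. h g \<in> generate H (insert x V)}) \<and>
    card (derived G {g \<in> carrier G. h g \<in> generate H (insert x V)})
      \<le> card V * card (derived G {g \<in> carrier G. h g \<in> V})"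
proof -
  interpret V: subgroup V H by fact
  let ?V2 = "generate H (insert x V)"
  let ?W = "{g \<in> carrier G. h g \<in> V}" and ?W2 = "{g \<in> carrier G. h g \<in> ?V2}"
  let ?K = "G\<lparr>carrier := ?W2\<rparr>"
  have xV: "insert x V \<subseteq> carrier H" using x V.subset by blast
  have V2: "subgroup ?V2 H" by (rule H.generate_is_subgroup[OF xV])
  have VV2: "V \<subseteq> ?V2" "x \<in> ?V2" by (auto intro: generate.incl)
  have W: "subgroup ?W G" by (rule subgroup_preimage[OF V(1)])
  have W2: "subgroup ?W2 G" by (rule subgroup_preimage[OF V2])
  have WW2: "?W \<subseteq> ?W2" using VV2 by auto
  interpret K: group ?K by (rule G.subgroup_imp_group[OF W2])
  obtain y where y: "y \<in> carrier G" "h y = x" using surj x by (metis imageE)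
  have yK: "y \<in> ?W2" using y VV2 by simp
  have normal: "?W \<lhd> ?K"
  proof -
    have "subgroup ?W ?K" by (rule G.subgroup_incl[OF W W2 WW2])
    moreover have "g \<otimes>\<^bsub>?K\<^esub> w \<otimes>\<^bsub>?K\<^esub> inv\<^bsub>?K\<^esub> g \<in> ?W" if g: "g \<in> carrier ?K" and w: "w \<in> ?W" for g w
    proof -
      have gc: "g \<in> carrier G" "h g \<in> ?V2" using g by auto
      have "h g \<otimes>\<^bsub>H\<^esub> h w \<otimes>\<^bsub>H\<^esub> inv\<^bsub>H\<^esub> h g \<in> V"
      proof (rule H.conj_generate[OF xV V.subset _ _ gc(2)])
        show "h w \<in> V" using w by simp
        fix u v assume uv: "u \<in> insert x V" "v \<in> V"
        show "u \<otimes>\<^bsub>H\<^esub> v \<otimes>\<^bsub>H\<^esub> inv\<^bsub>H\<^esub> u \<in> V"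
        proof (cases "u = x")
          case True then show ?thesis using conj[OF uv(2)] by simp
        next
          case False then show ?thesis using uv by simp
        qed
        show "inv\<^bsub>H\<^esub> u \<otimes>\<^bsub>H\<^esub> v \<otimes>\<^bsub>H\<^esub> u \<in> V"
        proof (cases "u = x")
          case True
          then show ?thesis using H.conj_inv_mem_of_finite[OF V(2) V.subset x conj uv(2)] by simp
        next
          case False then show ?thesis using uv by simp
        qed
      qed
      then show ?thesis using gc w G.m_inv_consistent[OF W2, of g] by simp
    qed
    ultimately show ?thesis unfolding K.normal_inv_iff by blast
  qed
  have gen: "generate ?K (insert y ?W) = carrier ?K"
  proof -
    have yW: "insert y ?W \<subseteq> ?W2" using yK WW2 by blast
    have yWG: "insert y ?W \<subseteq> carrier G" using y by auto
    have sub: "subgroup (generate G (insert y ?W)) G" by (rule G.generate_is_subgroup[OF yWG])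
    have "generate G (insert y ?W) = ?W2"
    proof
      show "generate G (insert y ?W) \<subseteq> ?W2" by (rule G.generate_subgroup_incl[OF yW W2])
      show "?W2 \<subseteq> generate G (insert y ?W)"
      proof
        fix g assume g: "g \<in> ?W2"
        have "h ` insert y ?W = insert x V"
        proof -
          have "h ` ?W = V"
          proof
            show "V \<subseteq> h ` ?W"
            proof
              fix v assume v: "v \<in> V"
              then have "v \<in> h ` carrier G" using surj V.mem_carrier by simp
              then show "v \<in> h ` ?W" using v by blast
            qed
          qed auto
          then show ?thesis using y by simp
        qed
        then have "h g \<in> h ` generate G (insert y ?W)" using g generate_img[OF yWG] by simp
        then obtain k where k: "k \<in> generate G (insert y ?W)" "h g = h k" by blast
        have kc: "k \<in> carrier G" using k(1) subgroup.mem_carrier[OF sub] by blast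
        \<comment> \<open>The preimage of \<open>V\<close> contains the kernel, so elements with
          equal images differ by a member of \<open>?W\<close>.\<close>
        have "g \<otimes> inv k \<in> ?W" using g kc k(2) V.one_closed by simp
        then have "g \<otimes> inv k \<in> generate G (insert y ?W)" by (simp add: generate.incl)
        then have "g \<otimes> inv k \<otimes> k \<in> generate G (insert y ?W)" using subgroup.m_closed[OF sub _ k(1)] by blast
        then show "g \<in> generate G (insert y ?W)" using g kc by (simp add: G.m_assoc)
      qed
    qed
    then show ?thesis using G.generate_consistent[OF yW W2] by simp
  qed
  have inv_eq: "inv\<^bsub>?K\<^esub> a = inv a" if "a \<in> ?W2" for a using G.m_inv_consistent[OF W2 that] .
  have dep: "v \<otimes>\<^bsub>?K\<^esub> y \<otimes>\<^bsub>?K\<^esub> inv\<^bsub>?K\<^esub> v \<otimes>\<^bsub>?K\<^esub> inv\<^bsub>?K\<^esub> y = w \<otimes>\<^bsub>?K\<^esub> y \<otimes>\<^bsub>?K\<^esub> inv\<^bsub>?K\<^esub> w \<otimes>\<^bsub>?K\<^esub> inv\<^bsub>?K\<^esub> y"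
    if v: "v \<in> ?W" and w: "w \<in> ?W" and eq: "h v = h w" for v w
  proof -
    have c: "v \<in> carrier G" "w \<in> carrier G" using v w by auto
    let ?z = "inv w \<otimes> v"
    have z: "?z \<in> carrier G" "h ?z = \<one>\<^bsub>H\<^esub>" using c eq by simp_all
    have zy: "?z \<otimes> y = y \<otimes> ?z" by (rule central[OF z y(1)])
    have "v \<otimes> y \<otimes> inv v = w \<otimes> (?z \<otimes> y) \<otimes> inv ?z \<otimes> inv w"
      using c y by (simp add: G.m_assoc G.inv_mult_group)
    also have "\<dots> = w \<otimes> y \<otimes> (?z \<otimes> inv ?z) \<otimes> inv w"
      unfolding zy using c y z by (simp add: G.m_assoc del: G.r_inv)
    also have "\<dots> = w \<otimes> y \<otimes> inv w" using G.r_inv[OF z(1)] c y by simp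
    finally show ?thesis using v w WW2 yK inv_eq by (simp add: subset_iff)
  qed
  have "derived ?K ?W = derived G ?W" "derived ?K (carrier ?K) = derived G ?W2"
    using G.derived_consistent[OF WW2 W2] G.derived_consistent[OF _ W2, of ?W2] by auto
  moreover have "finite (derived ?K (carrier ?K)) \<and> card (derived ?K (carrier ?K)) \<le> card V * card (derived ?K ?W)"
  proof (rule K.card_derived_cyclic_extension[OF normal _ gen _ V(2) _ dep])
    show "y \<in> carrier ?K" using yK by simp
    show "finite (derived ?K ?W)" using fin G.derived_consistent[OF WW2 W2] by simp
    show "h ` ?W \<subseteq> V" by auto
  qed
  ultimately show ?thesis by simp
qed

text \<open>A \<open>good\<close> subgroup of largest order must be \<open>S\<close>: otherwise a
  normalizing element outside it yields a subgroup at least twice as large, while the bound on the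
  derived group grows by one factor \<open>card S\<close>. The exponent \<open>j\<close> counts
  these doublings.\<close>

lemma card_derived_preimage_prime_power:
  assumes surj: "h ` carrier G = carrier H"
    and central: "\<And>z g. z \<in> carrier G \<Longrightarrow> h z = \<one>\<^bsub>H\<^esub> \<Longrightarrow> g \<in> carrier G \<Longrightarrow> z \<otimes> g = g \<otimes> z"
    and S: "subgroup S H" "card S = p ^ n" and p: "Factorial_Ring.prime (p::nat)"
  shows "finite (derived G {g \<in> carrier G. h g \<in> S}) \<and>
    (\<exists>j. 2 ^ j \<le> card S \<and> card (derived G {g \<in> carrier G. h g \<in> S}) \<le> card S ^ j)"
proof -
  interpret S: subgroup S H by fact
  let ?D = "\<lambda>V. derived G {g \<in> carrier G. h g \<in> V}"
  define good where "good V \<longleftrightarrow> subgroup V H \<and> V \<subseteq> S \<and> finite (?D V) \<and>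
      (\<exists>j. 2 ^ j \<le> card V \<and> card (?D V) \<le> card S ^ j)" for V
  have S0: "card S > 0" using S(2) p by (simp add: prime_gt_0_nat)
  then have finS: "finite S" using card_gt_0_iff by blast
  \<comment> \<open>The construction starts at the kernel, which is central and so has trivial
    derived group.\<close>
  have "?D {\<one>\<^bsub>H\<^esub>} = {\<one>}" by (rule derived_kernel_central[OF central])
  then have good_one: "good {\<one>\<^bsub>H\<^esub>}"
    unfolding good_def using H.triv_subgroup S.one_closed by (intro conjI exI[of _ 0]) simp_all
  have "\<forall>V. good V \<longrightarrow> card V < Suc (card S)"
  proof (intro allI impI)
    fix V assume "good V"
    then have "V \<subseteq> S" by (simp add: good_def)
    then show "card V < Suc (card S)" using card_mono[OF finS] by (simp add: less_Suc_eq_le)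
  qed
  from ex_has_greatest_nat[OF good_one this]
  obtain V where V: "good V" "\<And>U. good U \<Longrightarrow> card U \<le> card V" by blast
  have "V = S"
  proof (rule ccontr)
    assume "V \<noteq> S"
    let ?SS = "H\<lparr>carrier := S\<rparr>"
    interpret SS: group ?SS by (rule H.subgroup_imp_group[OF S(1)])
    obtain j where V': "subgroup V H" "V \<subseteq> S" "finite (?D V)" "2 ^ j \<le> card V" "card (?D V) \<le> card S ^ j"
      using V(1) unfolding good_def by blast
    interpret V: subgroup V H by fact
    have VS: "subgroup V ?SS" by (rule H.subgroup_incl[OF V'(1) S(1) V'(2)])
    have finV: "finite V" using V'(2) finS finite_subset by blast
    have "Coset.order ?SS = p ^ n" using S(2) by (simp add: Coset.order_def)
    then have "\<exists>x\<in>S - V. \<forall>v\<in>V. x \<otimes>\<^bsub>H\<^esub> v \<otimes>\<^bsub>H\<^esub> inv\<^bsub>?SS\<^esub> x \<in> V"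
      using SS.prime_power_order_normalizer_grows[OF p _ VS, of n] \<open>V \<noteq> S\<close> by simp
    then obtain x where x: "x \<in> S" "x \<notin> V" "\<And>v. v \<in> V \<Longrightarrow> x \<otimes>\<^bsub>H\<^esub> v \<otimes>\<^bsub>H\<^esub> inv\<^bsub>?SS\<^esub> x \<in> V"
      by blast
    have conj: "x \<otimes>\<^bsub>H\<^esub> v \<otimes>\<^bsub>H\<^esub> inv\<^bsub>H\<^esub> x \<in> V" if "v \<in> V" for v
      using x(3)[OF that] H.m_inv_consistent[OF S(1) x(1)] by simp
    have xc: "x \<in> carrier H" using x(1) S.mem_carrier by blast
    have xV: "insert x V \<subseteq> carrier H" using xc V.subset by blast
    let ?V2 = "generate H (insert x V)"
    have V2: "subgroup ?V2 H" by (rule H.generate_is_subgroup[OF xV])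
    have sub: "V \<subseteq> ?V2" "x \<in> ?V2" by (auto intro: generate.incl)
    have V2S: "?V2 \<subseteq> S" using x(1) V'(2) by (intro H.generate_subgroup_incl[OF _ S(1)]) blast
    then have finV2: "finite ?V2" using finS finite_subset by blast
    have step: "finite (?D ?V2) \<and> card (?D ?V2) \<le> card V * card (?D V)"
      by (rule card_derived_preimage_extension[OF surj central V'(1) finV xc conj V'(3)])
    have less: "card V < card ?V2" using sub x(2) finV2 by (intro psubset_card_mono) blast+
    have "card V dvd card ?V2"
    proof -
      interpret K2: group "H\<lparr>carrier := ?V2\<rparr>" by (rule H.subgroup_imp_group[OF V2])
      have "subgroup V (H\<lparr>carrier := ?V2\<rparr>)" by (rule H.subgroup_incl[OF V'(1) V2 sub(1)])
      from K2.lagrange[OF this] have "card ?V2 = card (rcosets\<^bsub>H\<lparr>carrier := ?V2\<rparr>\<^esub> V) * card V"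
        by (simp add: Coset.order_def)
      then show ?thesis by (metis dvd_triv_right)
    qed
    then obtain m where m: "card ?V2 = card V * m" by blast
    \<comment> \<open>\<open>m\<close> is the index of \<open>V\<close> in its enlargement, at least
      2 because \<open>V\<close> is a proper subgroup.\<close>
    then have "m \<noteq> 0" "m \<noteq> 1" using less by auto
    then have "2 \<le> m" by simp
    then have "card V * 2 \<le> card ?V2" unfolding m by (rule mult_left_mono) simp
    then have "2 ^ Suc j \<le> card ?V2" using V'(4) by simp
    moreover have "card (?D ?V2) \<le> card S ^ Suc j"
    proof -
      have "card V \<le> card S" using card_mono[OF finS V'(2)] .
      then have "card V * card (?D V) \<le> card S * card S ^ j" using V'(5) by (intro mult_mono) simp_all
      then show ?thesis using step by simp
    qed
    ultimately have "good ?V2" unfolding good_def using V2 V2S conjunct1[OF step] by (intro conjI exI[of _ "Suc j"])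
    then show False using V(2)[of ?V2] less by simp
  qed
  then show ?thesis using V(1) by (simp add: good_def)
qed

lemma card_rcosets_preimage:
  assumes surj: "h ` carrier G = carrier H" and S: "subgroup S H"
  shows "card (rcosets\<^bsub>G\<^esub> {g \<in> carrier G. h g \<in> S}) = card (rcosets\<^bsub>H\<^esub> S)"
proof -
  interpret S: subgroup S H by fact
  let ?W = "{g \<in> carrier G. h g \<in> S}"
  let ?b = "\<lambda>C. {k \<in> carrier G. h k \<in> C}"
  have W: "subgroup ?W G" by (rule subgroup_preimage[OF S])
  have eq: "?b (S #>\<^bsub>H\<^esub> h g) = ?W #> g" if g: "g \<in> carrier G" for g
  proof (intro equalityI subsetI)
    fix k assume k: "k \<in> ?b (S #>\<^bsub>H\<^esub> h g)"
    then have "h k \<otimes>\<^bsub>H\<^esub> inv\<^bsub>H\<^esub> h g \<in> S" using S.rcos_module_imp[OF H.is_group] g by simp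
    then have "k \<otimes> inv g \<in> ?W" using k g by simp
    then show "k \<in> ?W #> g" using subgroup.rcos_module_rev[OF W G.is_group g] k by simp
  next
    fix k assume k: "k \<in> ?W #> g"
    then have kc: "k \<in> carrier G" using G.r_coset_subset_G[OF subgroup.subset[OF W] g] by blast
    have "k \<otimes> inv g \<in> ?W" using subgroup.rcos_module_imp[OF W G.is_group g k] .
    then have "h k \<otimes>\<^bsub>H\<^esub> inv\<^bsub>H\<^esub> h g \<in> S" using kc g by simp
    then show "k \<in> ?b (S #>\<^bsub>H\<^esub> h g)" using S.rcos_module_rev[OF H.is_group] kc g by simp
  qed
  have "bij_betw ?b (rcosets\<^bsub>H\<^esub> S) (rcosets\<^bsub>G\<^esub> ?W)"
  proof (rule bij_betwI')
    show "?b C \<in> rcosets\<^bsub>G\<^esub> ?W" if C: "C \<in> rcosets\<^bsub>H\<^esub> S" for C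
    proof -
      obtain x where x: "x \<in> carrier H" "C = S #>\<^bsub>H\<^esub> x" using C unfolding RCOSETS_def by blast
      have "x \<in> h ` carrier G" using x(1) surj by simp
      then obtain g where g: "g \<in> carrier G" "C = S #>\<^bsub>H\<^esub> h g" using x(2) by blast
      then show ?thesis unfolding g(2) eq[OF g(1)] by (intro G.rcosetsI[OF subgroup.subset[OF W]])
    qed
    show "(?b C = ?b D) = (C = D)" if C: "C \<in> rcosets\<^bsub>H\<^esub> S" and D: "D \<in> rcosets\<^bsub>H\<^esub> S" for C D
    proof -
      have img: "h ` ?b T = T" if "T \<in> rcosets\<^bsub>H\<^esub> S" for T
      proof -
        have "T \<subseteq> h ` carrier G" using S.rcosets_carrier[OF H.is_group that] surj by simp
        show ?thesis
        proof
          show "T \<subseteq> h ` ?b T"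
          proof
            fix x assume x: "x \<in> T"
            then obtain k where "k \<in> carrier G" "x = h k" using \<open>T \<subseteq> h ` carrier G\<close> by blast
            then show "x \<in> h ` ?b T" using x by simp
          qed
        qed (rule image_subsetI, simp)
      qed
      show ?thesis
      proof
        assume "?b C = ?b D"
        then have "h ` ?b C = h ` ?b D" by (rule arg_cong)
        then show "C = D" unfolding img[OF C] img[OF D] .
      qed simp
    qed
    show "\<exists>D\<in>rcosets\<^bsub>H\<^esub> S. C = ?b D" if C: "C \<in> rcosets\<^bsub>G\<^esub> ?W" for C
    proof -
      obtain g where g: "g \<in> carrier G" "C = ?W #> g" using C unfolding RCOSETS_def by blast
      show ?thesis
      proof
        show "S #>\<^bsub>H\<^esub> h g \<in> rcosets\<^bsub>H\<^esub> S" by (rule H.rcosetsI[OF S.subset hom_closed[OF g(1)]])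
        show "C = ?b (S #>\<^bsub>H\<^esub> h g)" unfolding g(2) by (rule eq[OF g(1), symmetric])
      qed
    qed
  qed
  from bij_betw_same_card[OF this] show ?thesis by (rule HOL.sym)
qed

text \<open>Transfer to the preimage of a Sylow \<open>p\<close>-subgroup raises a central element of the derived group
  to a power prime to \<open>p\<close>, so jointly for all \<open>p\<close> these power maps are injective.\<close>

lemma card_central_kernel_Int_derived:
  assumes surj: "h ` carrier G = carrier H"
    and central: "\<And>z g. z \<in> carrier G \<Longrightarrow> h z = \<one>\<^bsub>H\<^esub> \<Longrightarrow> g \<in> carrier G \<Longrightarrow> z \<otimes> g = g \<otimes> z"
    and fin: "finite (carrier H)"
  shows "finite (kernel G H h \<inter> derived G (carrier G)) \<and>
    (\<exists>J. 2 ^ J \<le> card (carrier H) \<and>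
      card (kernel G H h \<inter> derived G (carrier G)) \<le> card (carrier H) ^ J)"
proof -
  define F where "F = card (carrier H)"
  define K where "K = kernel G H h \<inter> derived G (carrier G)"
  let ?W = "\<lambda>S. {g \<in> carrier G. h g \<in> S}"
  have "carrier H \<noteq> {}" using H.one_closed by blast
  then have F0: "F > 0" unfolding F_def using fin by (simp add: card_gt_0_iff)
  have K: "subgroup K G" unfolding K_def
    by (intro G.subgroups_Inter_pair subgroup_kernel G.derived_is_subgroup) simp
  interpret K: subgroup K G by (rule K)
  have Kh: "h z = \<one>\<^bsub>H\<^esub>" if "z \<in> K" for z using that unfolding K_def kernel_def by blast
  have Kcomm: "z \<otimes> g = g \<otimes> z" if "z \<in> K" "g \<in> carrier G" for z g
    using central[OF K.mem_carrier[OF that(1)] Kh[OF that(1)] that(2)] .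
  have index: "card (rcosets\<^bsub>H\<^esub> S) * card S = F" if "subgroup S H" for S
    using H.lagrange[OF that] by (simp add: F_def Coset.order_def)
  have transfer: "z [^] card (rcosets\<^bsub>H\<^esub> S) \<in> derived G (?W S)" if z: "z \<in> K" and S: "subgroup S H" for z S
  proof -
    have "card (rcosets\<^bsub>H\<^esub> S) > 0" using index[OF S] F0 by (cases "card (rcosets\<^bsub>H\<^esub> S)") auto
    then have "finite (rcosets\<^bsub>G\<^esub> (?W S))" using card_rcosets_preimage[OF surj S] card_gt_0_iff by metis
    moreover have "z \<in> ?W S" using z Kh subgroup.one_closed[OF S] by simp
    moreover have "z \<in> derived G (carrier G)" using z by (simp add: K_def)
    ultimately have "z [^] card (rcosets\<^bsub>G\<^esub> (?W S)) \<in> derived G (?W S)"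
      using Kcomm[OF z] by (intro G.derived_central_power_mem_derived[OF subgroup_preimage[OF S]])
    then show ?thesis by (simp only: card_rcosets_preimage[OF surj S])
  qed
  \<comment> \<open>\<open>J\<close> is the floor of the binary logarithm of \<open>F\<close>. A
    single exponent serves all primes, so the Sylow bounds multiply to a power of
    \<open>F\<close>.\<close>
  obtain J where J: "2 ^ J \<le> F" "F < 2 ^ (J + 1)" using ex_power_ivl1[of 2 F] F0 by auto
  have "\<exists>S. subgroup S H \<and> card S = p ^ multiplicity p F" if "p \<in> prime_factors F" for p
  proof -
    obtain m where "F = p ^ multiplicity p F * m" using multiplicity_dvd[of p F] by (elim dvdE)
    then show ?thesis using sylow_thm[of p H "multiplicity p F" m] that fin H.is_group
      by (simp add: F_def Coset.order_def in_prime_factors_iff)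
  qed
  then obtain S where S: "\<And>p. p \<in> prime_factors F \<Longrightarrow> subgroup (S p) H"
    "\<And>p. p \<in> prime_factors F \<Longrightarrow> card (S p) = p ^ multiplicity p F" by metis
  define m where "m p = card (rcosets\<^bsub>H\<^esub> (S p))" for p
  have mF: "m p * p ^ multiplicity p F = F" if "p \<in> prime_factors F" for p
    using index[OF S(1)[OF that]] S(2)[OF that] by (simp add: m_def)
  define D where "D p = derived G (?W (S p))" for p
  have D: "finite (D p)" "card (D p) \<le> (p ^ multiplicity p F) ^ J" if p: "p \<in> prime_factors F" for p
  proof -
    have pp: "Factorial_Ring.prime p" using p by (simp add: in_prime_factors_iff)
    obtain j where j: "finite (D p)" "2 ^ j \<le> card (S p)" "card (D p) \<le> card (S p) ^ j"
      using card_derived_preimage_prime_power[OF surj central S(1)[OF p] S(2)[OF p] pp] unfolding D_def by blast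
    show "finite (D p)" by fact
    have "card (S p) dvd F" using index[OF S(1)[OF p]] by (metis dvd_triv_right)
    then have "card (S p) \<le> F" using F0 by (rule dvd_imp_le)
    then have "(2::nat) ^ j < 2 ^ (J + 1)" using j(2) J(2) by linarith
    then have "j < J + 1" by (rule power_less_imp_less_exp[rotated]) simp
    then have "j \<le> J" by simp
    moreover have "1 \<le> card (S p)" using S(2)[OF p] pp by (simp add: prime_gt_0_nat Suc_leI)
    ultimately have "card (S p) ^ j \<le> card (S p) ^ J" by (rule power_increasing)
    then show "card (D p) \<le> (p ^ multiplicity p F) ^ J" using j(3) S(2)[OF p] by simp
  qed
  \<comment> \<open>The component at \<open>p\<close> is the power by the index of
    \<open>S p\<close>, which \<open>transfer\<close> places in \<open>D p\<close>.\<close>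
  let ?Phi = "\<lambda>z. \<lambda>p\<in>prime_factors F. z [^] m p"
  have into: "?Phi ` K \<subseteq> Pi\<^sub>E (prime_factors F) D"
    using transfer S(1) by (intro image_subsetI PiE_I) (simp_all add: m_def D_def)
  have inj: "inj_on ?Phi K"
  proof (rule inj_onI)
    fix z w assume z: "z \<in> K" and w: "w \<in> K" and eq: "?Phi z = ?Phi w"
    let ?y = "z \<otimes> inv w"
    have zc: "z \<in> carrier G" "w \<in> carrier G" using z w K.mem_carrier by auto
    have y: "?y \<in> K" using z w by simp
    have ym: "?y [^] m p = \<one>" if p: "p \<in> prime_factors F" for p
    proof -
      have "z [^] m p = w [^] m p" using fun_cong[OF eq, of p] p by simp
      moreover have "?y [^] m p = z [^] m p \<otimes> inv w [^] m p"
        using zc Kcomm[OF z] by (intro G.pow_mult_distrib) simp_all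
      ultimately show ?thesis using zc by (simp add: G.nat_pow_inv)
    qed
    \<comment> \<open>The preimage of the trivial subgroup is the central kernel, whose derived
      group is trivial, so transfer to it gives exponent \<open>F\<close>.\<close>
    have "?y [^] card (rcosets\<^bsub>H\<^esub> {\<one>\<^bsub>H\<^esub>}) \<in> derived G (?W {\<one>\<^bsub>H\<^esub>})"
      by (rule transfer[OF y H.triv_subgroup])
    then have "?y [^] F = \<one>"
      using derived_kernel_central[OF central] index[OF H.triv_subgroup] by simp
    then have ordF: "group.ord G ?y dvd F" using G.pow_eq_id zc by simp
    \<comment> \<open>A prime \<open>p\<close> dividing the order would divide \<open>F\<close> and
      also the index \<open>m p\<close>, although the Sylow subgroup has absorbed every factor
      \<open>p\<close> of \<open>F\<close>.\<close>
    have "group.ord G ?y = 1"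
    proof (rule ccontr)
      assume "group.ord G ?y \<noteq> 1"
      then obtain p where p: "Factorial_Ring.prime p" "p dvd group.ord G ?y" using prime_factor_nat by blast
      have pF: "p \<in> prime_factors F" using p ordF F0 by (simp add: in_prime_factors_iff dvd_trans[OF p(2) ordF])
      have "group.ord G ?y dvd m p" using ym[OF pF] G.pow_eq_id zc by simp
      then have "p dvd m p" using p(2) dvd_trans by blast
      then have "p * p ^ multiplicity p F dvd m p * p ^ multiplicity p F" by (rule mult_dvd_mono) simp
      then have "p ^ Suc (multiplicity p F) dvd F" using mF[OF pF] by simp
      moreover have "\<not> is_unit p" using p(1) not_prime_unit by blast
      ultimately have "Suc (multiplicity p F) \<le> multiplicity p F"
        using F0 multiplicity_geI by blast
      then show False by simp
    qed
    then have "?y = \<one>" using G.pow_eq_id[of ?y 1] zc by simp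
    then show "z = w" using zc by (metis G.inv_equality G.inv_inv G.inv_closed)
  qed
  have finP: "finite (Pi\<^sub>E (prime_factors F) D)" using D(1) by (intro finite_PiE) simp_all
  have "card K = card (?Phi ` K)" using card_image[OF inj] by simp
  also have "\<dots> \<le> card (Pi\<^sub>E (prime_factors F) D)" by (rule card_mono[OF finP into])
  also have "\<dots> = (\<Prod>p\<in>prime_factors F. card (D p))" by (rule card_PiE) simp
  also have "\<dots> \<le> (\<Prod>p\<in>prime_factors F. (p ^ multiplicity p F) ^ J)" using D(2) by (intro prod_mono) simp
  also have "\<dots> = (\<Prod>p\<in>prime_factors F. p ^ multiplicity p F) ^ J" by (rule prod_power_distrib[symmetric])
  also have "(\<Prod>p\<in>prime_factors F. p ^ multiplicity p F) = F" using prime_factorization_nat[OF F0] by simp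
  finally have "card K \<le> F ^ J" .
  moreover have "finite K" using finite_imageD[OF finite_subset[OF into finP] inj] .
  ultimately show ?thesis using J(1) unfolding K_def F_def by blast
qed

end

section \<open>Subgroups of direct products\<close>

text \<open>By \<open>faithful\<close>, \<open>f\<close> and \<open>g\<close> together embed
  \<open>U\<close> into the product of \<open>P\<close> and \<open>Q\<close>. A torsion class of
  \<open>U\<close> is recovered from its classes in the abelianizations of \<open>P\<close> and
  \<open>Q\<close> and one element of \<open>K\<close>, the part of the derived group of
  \<open>Q Mod M\<close> that dies in \<open>Q Mod N\<close>.\<close>

lemma card_torsion_subdirect:
  assumes f: "group_hom U P f" "f ` carrier U = carrier P" and g: "group_hom U Q g" "g ` carrier U = carrier Q"
    and faithful: "\<And>u. u \<in> carrier U \<Longrightarrow> f u = \<one>\<^bsub>P\<^esub> \<Longrightarrow> g u = \<one>\<^bsub>Q\<^esub> \<Longrightarrow> u = \<one>\<^bsub>U\<^esub>"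
    and finP: "finite (torsion (abelianization P))" and finQ: "finite (torsion (abelianization Q))"
    and index: "finite (rcosets\<^bsub>Q\<^esub> (g ` kernel U P f))"
  shows "\<exists>J. 2 ^ J \<le> card (rcosets\<^bsub>Q\<^esub> (g ` kernel U P f)) \<and>
    card (torsion (abelianization U)) \<le>
      card (torsion (abelianization P)) * card (torsion (abelianization Q))
        * card (rcosets\<^bsub>Q\<^esub> (g ` kernel U P f)) ^ J"
proof -
  interpret f: group_hom U P f by fact
  interpret g: group_hom U Q g by fact
  let ?DU = "derived U (carrier U)" and ?DP = "derived P (carrier P)" and ?DQ = "derived Q (carrier Q)"
  interpret DU: normal ?DU U by (rule f.G.derived_is_normal[OF f.G.normal_self])
  interpret DP: normal ?DP P by (rule f.H.derived_is_normal[OF f.H.normal_self])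
  interpret DQ: normal ?DQ Q by (rule g.H.derived_is_normal[OF g.H.normal_self])
  have fD: "f ` ?DU = ?DP" using f.derived_img[of "carrier U"] f(2) by simp
  have gD: "g ` ?DU = ?DQ" using g.derived_img[of "carrier U"] g(2) by simp

  define N where "N = g ` kernel U P f"
  interpret ker: normal "kernel U P f" U by (rule f.normal_kernel)
  have N: "N \<lhd> Q" unfolding N_def by (rule ker.surj_hom_normal_subgroup[OF g])
  interpret N: normal N Q by (rule N)
  \<comment> \<open>These commutators generate [N, Q], called \<open>M\<close>; the set is invariant
    under conjugation, whence \<open>M\<close> is normal.\<close>
  define Y where "Y = {n \<otimes>\<^bsub>Q\<^esub> q \<otimes>\<^bsub>Q\<^esub> inv\<^bsub>Q\<^esub> n \<otimes>\<^bsub>Q\<^esub> inv\<^bsub>Q\<^esub> q | n q. n \<in> N \<and> q \<in> carrier Q}"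
  define M where "M = generate Q Y"
  have YN: "Y \<subseteq> N"
  proof
    fix y assume "y \<in> Y"
    then obtain n q where nq: "n \<in> N" "q \<in> carrier Q"
      "y = n \<otimes>\<^bsub>Q\<^esub> q \<otimes>\<^bsub>Q\<^esub> inv\<^bsub>Q\<^esub> n \<otimes>\<^bsub>Q\<^esub> inv\<^bsub>Q\<^esub> q" unfolding Y_def by blast
    have "q \<otimes>\<^bsub>Q\<^esub> inv\<^bsub>Q\<^esub> n \<otimes>\<^bsub>Q\<^esub> inv\<^bsub>Q\<^esub> q \<in> N" using N.inv_op_closed2[OF nq(2), of "inv\<^bsub>Q\<^esub> n"] nq(1) by simp
    then have "n \<otimes>\<^bsub>Q\<^esub> (q \<otimes>\<^bsub>Q\<^esub> inv\<^bsub>Q\<^esub> n \<otimes>\<^bsub>Q\<^esub> inv\<^bsub>Q\<^esub> q) \<in> N" using nq(1) by simp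
    then show "y \<in> N" using nq N.mem_carrier[OF nq(1)] by (simp add: g.H.m_assoc)
  qed
  have YQ: "Y \<subseteq> carrier Q" using YN N.subset by blast
  have "M \<lhd> Q" unfolding M_def
  proof (rule g.H.normal_generateI[OF YQ])
    fix y k assume "y \<in> Y" and k: "k \<in> carrier Q"
    then obtain n q where nq: "n \<in> N" "q \<in> carrier Q"
      "y = n \<otimes>\<^bsub>Q\<^esub> q \<otimes>\<^bsub>Q\<^esub> inv\<^bsub>Q\<^esub> n \<otimes>\<^bsub>Q\<^esub> inv\<^bsub>Q\<^esub> q" unfolding Y_def by blast
    let ?c = "\<lambda>a. k \<otimes>\<^bsub>Q\<^esub> a \<otimes>\<^bsub>Q\<^esub> inv\<^bsub>Q\<^esub> k"
    have "?c n \<in> N" by (rule N.inv_op_closed2[OF k nq(1)])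
    moreover have "?c q \<in> carrier Q" using k nq by simp
    moreover have "?c y = ?c n \<otimes>\<^bsub>Q\<^esub> ?c q \<otimes>\<^bsub>Q\<^esub> inv\<^bsub>Q\<^esub> ?c n \<otimes>\<^bsub>Q\<^esub> inv\<^bsub>Q\<^esub> ?c q"
      using k nq N.mem_carrier[OF nq(1)] by (simp add: g.H.m_assoc g.H.inv_mult_group)
    ultimately show "?c y \<in> Y" unfolding Y_def by blast
  qed
  then interpret M: normal M Q .
  have MN: "M \<subseteq> N" unfolding M_def by (rule g.H.generate_subgroup_incl[OF YN N.subgroup_axioms])

  \<comment> \<open>If \<open>f a\<close> is trivial, the commutator of \<open>a\<close> and
    \<open>b\<close> lies in the kernel of \<open>f\<close> and in the derived group of
    \<open>U\<close>, and \<open>g\<close> maps it to the commutator of \<open>g a\<close> and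
    \<open>g b\<close>. So all of \<open>M\<close> lifts to this intersection, and
    \<open>faithful\<close> makes the lift unique.\<close>
  have M_lift: "u \<in> ?DU" if u: "u \<in> carrier U" "f u = \<one>\<^bsub>P\<^esub>" "g u \<in> M" for u
  proof -
    let ?L = "?DU \<inter> kernel U P f"
    have L: "subgroup ?L U" by (rule f.G.subgroups_Inter_pair[OF DU.subgroup_axioms ker.subgroup_axioms])
    have gL: "subgroup (g ` ?L) Q" by (rule g.subgroup_img_is_subgroup[OF L])
    have "Y \<subseteq> g ` ?L"
    proof
      fix y assume "y \<in> Y"
      then obtain n q where nq: "n \<in> N" "q \<in> carrier Q"
        "y = n \<otimes>\<^bsub>Q\<^esub> q \<otimes>\<^bsub>Q\<^esub> inv\<^bsub>Q\<^esub> n \<otimes>\<^bsub>Q\<^esub> inv\<^bsub>Q\<^esub> q" unfolding Y_def by blast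
      obtain a where a: "a \<in> kernel U P f" "n = g a" using nq(1) unfolding N_def by blast
      have "q \<in> g ` carrier U" using nq(2) g(2) by simp
      then obtain b where b: "b \<in> carrier U" "q = g b" by blast
      have ac: "a \<in> carrier U" "f a = \<one>\<^bsub>P\<^esub>" using a(1) unfolding kernel_def by auto
      let ?w = "a \<otimes>\<^bsub>U\<^esub> b \<otimes>\<^bsub>U\<^esub> inv\<^bsub>U\<^esub> a \<otimes>\<^bsub>U\<^esub> inv\<^bsub>U\<^esub> b"
      have "?w \<in> ?DU" unfolding derived_def using ac(1) b(1) by (intro generate.incl) blast
      moreover have "?w \<in> kernel U P f" unfolding kernel_def using ac b(1) by simp
      moreover have "g ?w = y" using ac(1) b nq(3) a(2) by simp
      ultimately show "y \<in> g ` ?L" by blast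
    qed
    then have "M \<subseteq> g ` ?L" unfolding M_def by (rule g.H.generate_subgroup_incl[OF _ gL])
    then obtain l where l: "l \<in> ?L" "g u = g l" using u(3) by blast
    have lc: "l \<in> carrier U" "f l = \<one>\<^bsub>P\<^esub>" "l \<in> ?DU" using l(1) unfolding kernel_def by auto
    have "u \<otimes>\<^bsub>U\<^esub> inv\<^bsub>U\<^esub> l = \<one>\<^bsub>U\<^esub>" using u lc l(2) by (intro faithful) simp_all
    then have "u = l" using f.G.inv_equality[of u "inv\<^bsub>U\<^esub> l"] u(1) lc(1) by simp
    then show ?thesis using lc(3) by simp
  qed

  \<comment> \<open>\<open>Q Mod M\<close> is a central extension of \<open>Q Mod N\<close>, since
    elements of \<open>N\<close> commute with everything modulo \<open>M\<close>. The map between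
    them multiplies a coset of \<open>M\<close> by \<open>N\<close>, which absorbs
    \<open>M\<close>.\<close>
  let ?E = "Q Mod M" and ?C = "Q Mod N" and ?h = "\<lambda>x. N <#>\<^bsub>Q\<^esub> x"
  interpret E: group ?E by (rule M.factorgroup_is_group)
  interpret C: group ?C by (rule N.factorgroup_is_group)
  have h_coset: "?h (M #>\<^bsub>Q\<^esub> q) = N #>\<^bsub>Q\<^esub> q" if q: "q \<in> carrier Q" for q
  proof -
    have "N <#>\<^bsub>Q\<^esub> M = N"
    proof
      show "N <#>\<^bsub>Q\<^esub> M \<subseteq> N" unfolding set_mult_def using MN N.m_closed by blast
      show "N \<subseteq> N <#>\<^bsub>Q\<^esub> M"
      proof
        fix n assume n: "n \<in> N"
        have "n \<otimes>\<^bsub>Q\<^esub> \<one>\<^bsub>Q\<^esub> \<in> N <#>\<^bsub>Q\<^esub> M" unfolding set_mult_def using n M.one_closed by blast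
        then show "n \<in> N <#>\<^bsub>Q\<^esub> M" using N.mem_carrier[OF n] by simp
      qed
    qed
    then show ?thesis using g.H.setmult_rcos_assoc[OF N.subset M.subset q] by simp
  qed
  have h_hom: "?h \<in> hom ?E ?C"
  proof (rule homI)
    fix x assume "x \<in> carrier ?E"
    then obtain q where q: "q \<in> carrier Q" "x = M #>\<^bsub>Q\<^esub> q" unfolding carrier_FactGroup by blast
    then show "?h x \<in> carrier ?C" using h_coset[OF q(1)] by (auto simp: carrier_FactGroup)
    fix y assume "y \<in> carrier ?E"
    then obtain r where r: "r \<in> carrier Q" "y = M #>\<^bsub>Q\<^esub> r" unfolding carrier_FactGroup by blast
    have "x \<otimes>\<^bsub>?E\<^esub> y = M #>\<^bsub>Q\<^esub> (q \<otimes>\<^bsub>Q\<^esub> r)" using q r M.rcos_sum by simp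
    then show "?h (x \<otimes>\<^bsub>?E\<^esub> y) = ?h x \<otimes>\<^bsub>?C\<^esub> ?h y" using q r h_coset N.rcos_sum by simp
  qed
  interpret h: group_hom ?E ?C ?h by (intro group_hom.intro group_hom_axioms.intro E.is_group C.is_group h_hom)
  interpret p: group_hom Q ?E "\<lambda>q. M #>\<^bsub>Q\<^esub> q"
    by (intro group_hom.intro group_hom_axioms.intro E.is_group g.H.is_group M.r_coset_hom_Mod)
  have p_img: "(\<lambda>q. M #>\<^bsub>Q\<^esub> q) ` carrier Q = carrier ?E" unfolding carrier_FactGroup by simp
  have h_surj: "?h ` carrier ?E = carrier ?C"
    unfolding carrier_FactGroup image_image using h_coset by (intro image_cong) simp_all
  have h_central: "z \<otimes>\<^bsub>?E\<^esub> x = x \<otimes>\<^bsub>?E\<^esub> z"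
    if z: "z \<in> carrier ?E" "?h z = \<one>\<^bsub>?C\<^esub>" and x: "x \<in> carrier ?E" for z x
  proof -
    obtain n where n: "n \<in> carrier Q" "z = M #>\<^bsub>Q\<^esub> n" using z(1) unfolding carrier_FactGroup by blast
    obtain q where q: "q \<in> carrier Q" "x = M #>\<^bsub>Q\<^esub> q" using x unfolding carrier_FactGroup by blast
    have "N #>\<^bsub>Q\<^esub> n = N" using z(2) h_coset[OF n(1)] n(2) by simp
    then have nN: "n \<in> N" by (rule g.H.coset_join1[OF _ n(1) N.subgroup_axioms])
    have "n \<otimes>\<^bsub>Q\<^esub> q \<otimes>\<^bsub>Q\<^esub> inv\<^bsub>Q\<^esub> n \<otimes>\<^bsub>Q\<^esub> inv\<^bsub>Q\<^esub> q \<in> M"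
      unfolding M_def Y_def using nN q(1) by (intro generate.incl) blast
    moreover have "n \<otimes>\<^bsub>Q\<^esub> q = (n \<otimes>\<^bsub>Q\<^esub> q \<otimes>\<^bsub>Q\<^esub> inv\<^bsub>Q\<^esub> n \<otimes>\<^bsub>Q\<^esub> inv\<^bsub>Q\<^esub> q) \<otimes>\<^bsub>Q\<^esub> (q \<otimes>\<^bsub>Q\<^esub> n)"
      using n(1) q(1) by (simp add: g.H.m_assoc)
    ultimately have "n \<otimes>\<^bsub>Q\<^esub> q \<in> M #>\<^bsub>Q\<^esub> (q \<otimes>\<^bsub>Q\<^esub> n)" unfolding r_coset_def by blast
    then have "M #>\<^bsub>Q\<^esub> (n \<otimes>\<^bsub>Q\<^esub> q) = M #>\<^bsub>Q\<^esub> (q \<otimes>\<^bsub>Q\<^esub> n)"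
      using g.H.repr_independence[OF _ _ M.subgroup_axioms, of "n \<otimes>\<^bsub>Q\<^esub> q" "q \<otimes>\<^bsub>Q\<^esub> n"] n(1) q(1) by simp
    then show ?thesis unfolding n(2) q(2) mult_FactGroup M.rcos_sum[OF n(1) q(1)] M.rcos_sum[OF q(1) n(1)] .
  qed
  define K where "K = kernel ?E ?C ?h \<inter> derived ?E (carrier ?E)"
  have finC: "finite (carrier ?C)" using index unfolding N_def[symmetric] by (simp add: FactGroup_def)
  have card_C: "card (carrier ?C) = card (rcosets\<^bsub>Q\<^esub> (g ` kernel U P f))"
    unfolding N_def[symmetric] by (simp add: FactGroup_def)
  obtain J where finK: "finite K" and J: "2 ^ J \<le> card (carrier ?C)" "card K \<le> card (carrier ?C) ^ J"
    using h.card_central_kernel_Int_derived[OF h_surj h_central finC] unfolding K_def by blast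

  define cls where "cls u = (?DP #>\<^bsub>P\<^esub> f u, ?DQ #>\<^bsub>Q\<^esub> g u)" for u
  \<comment> \<open>\<open>base\<close> picks any element with the prescribed pair of classes,
    whether or not its own class in the abelianization of \<open>U\<close> is torsion;
    \<open>lift\<close> picks a preimage inside the kernel of \<open>f\<close>.\<close>
  define base where "base c = (SOME u. u \<in> carrier U \<and> cls u = c)" for c
  define lift where "lift k = (SOME w. w \<in> carrier U \<and> f w = \<one>\<^bsub>P\<^esub> \<and> M #>\<^bsub>Q\<^esub> g w = k)" for k
  let ?T = "(torsion (abelianization P) \<times> torsion (abelianization Q)) \<times> K"
  have cover: "torsion (abelianization U) \<subseteq> (\<lambda>(c, k). ?DU #>\<^bsub>U\<^esub> (lift k \<otimes>\<^bsub>U\<^esub> base c)) ` ?T"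
  proof
    fix x assume "x \<in> torsion (abelianization U)"
    then obtain u n where u: "u \<in> carrier U" "x = ?DU #>\<^bsub>U\<^esub> u" and n: "n > 0" "u [^]\<^bsub>U\<^esub> (n::nat) \<in> ?DU"
      unfolding f.G.mem_torsion_abelianization_iff by blast
    have "f u [^]\<^bsub>P\<^esub> n \<in> ?DP" using fD n(2) f.hom_nat_pow[OF u(1)] by (metis imageI)
    then have tP: "?DP #>\<^bsub>P\<^esub> f u \<in> torsion (abelianization P)"
      unfolding f.H.mem_torsion_abelianization_iff using f.hom_closed[OF u(1)] n(1) by blast
    have "g u [^]\<^bsub>Q\<^esub> n \<in> ?DQ" using gD n(2) g.hom_nat_pow[OF u(1)] by (metis imageI)
    then have tQ: "?DQ #>\<^bsub>Q\<^esub> g u \<in> torsion (abelianization Q)"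
      unfolding g.H.mem_torsion_abelianization_iff using g.hom_closed[OF u(1)] n(1) by blast
    let ?b = "base (cls u)"
    have b: "?b \<in> carrier U \<and> cls ?b = cls u" unfolding base_def by (rule someI[of _ u]) (simp add: u)
    let ?w = "u \<otimes>\<^bsub>U\<^esub> inv\<^bsub>U\<^esub> ?b"
    have wc: "?w \<in> carrier U" using u(1) b by simp
    have fw: "f ?w \<in> ?DP"
    proof -
      have "f u \<in> ?DP #>\<^bsub>P\<^esub> f ?b"
        using f.H.rcos_self[OF f.hom_closed[OF u(1)] DP.subgroup_axioms] b by (simp add: cls_def)
      from DP.rcos_module_imp[OF f.H.is_group _ this] show ?thesis using u(1) b by simp
    qed
    have gw: "g ?w \<in> ?DQ"
    proof -
      have "g u \<in> ?DQ #>\<^bsub>Q\<^esub> g ?b"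
        using g.H.rcos_self[OF g.hom_closed[OF u(1)] DQ.subgroup_axioms] b by (simp add: cls_def)
      from DQ.rcos_module_imp[OF g.H.is_group _ this] show ?thesis using u(1) b by simp
    qed
    \<comment> \<open>Dividing by an element of the derived group of \<open>U\<close> moves
      \<open>?w\<close> into the kernel of \<open>f\<close>; its image under \<open>g\<close> then
      lies both in \<open>N\<close> and in \<open>?DQ\<close>.\<close>
    obtain d where d: "d \<in> ?DU" "f d = f ?w" using fw unfolding fD[symmetric] by (metis imageE)
    have dc: "d \<in> carrier U" using d(1) DU.mem_carrier by blast
    let ?v = "inv\<^bsub>U\<^esub> d \<otimes>\<^bsub>U\<^esub> ?w"
    have vc: "?v \<in> carrier U" using dc wc by simp
    have fv: "f ?v = \<one>\<^bsub>P\<^esub>"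
    proof -
      have "f ?v = inv\<^bsub>P\<^esub> f d \<otimes>\<^bsub>P\<^esub> f ?w" using dc wc by (simp only: f.hom_mult f.hom_inv f.G.inv_closed)
      then show ?thesis using f.hom_closed[OF wc] unfolding d(2) by simp
    qed
    have "g d \<in> ?DQ" using d(1) gD by blast
    then have gv: "g ?v \<in> ?DQ" using gw dc wc by (simp only: g.hom_mult g.hom_inv f.G.inv_closed DQ.m_closed DQ.m_inv_closed)
    let ?k = "M #>\<^bsub>Q\<^esub> g ?v"
    have gvN: "g ?v \<in> N" unfolding N_def kernel_def using vc fv by blast
    have kK: "?k \<in> K"
    proof -
      have "N #>\<^bsub>Q\<^esub> g ?v = N" by (rule g.H.coset_join2[OF g.hom_closed[OF vc] N.subgroup_axioms gvN])
      then have "?k \<in> kernel ?E ?C ?h"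
        unfolding kernel_def using h_coset[OF g.hom_closed[OF vc]] p.hom_closed[OF g.hom_closed[OF vc]] by simp
      moreover have "?k \<in> derived ?E (carrier ?E)"
        using p.derived_img[of "carrier Q"] gv unfolding p_img by blast
      ultimately show ?thesis unfolding K_def by blast
    qed
    let ?l = "lift ?k"
    have l: "?l \<in> carrier U \<and> f ?l = \<one>\<^bsub>P\<^esub> \<and> M #>\<^bsub>Q\<^esub> g ?l = ?k"
      unfolding lift_def by (rule someI[of _ ?v]) (use vc fv in simp)
    have vl: "?v \<otimes>\<^bsub>U\<^esub> inv\<^bsub>U\<^esub> ?l \<in> ?DU"
    proof (rule M_lift)
      have lc: "?l \<in> carrier U" "f ?l = \<one>\<^bsub>P\<^esub>" using l by auto
      show "?v \<otimes>\<^bsub>U\<^esub> inv\<^bsub>U\<^esub> ?l \<in> carrier U" by (rule f.G.m_closed[OF vc f.G.inv_closed[OF lc(1)]])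
      have "f (?v \<otimes>\<^bsub>U\<^esub> inv\<^bsub>U\<^esub> ?l) = f ?v \<otimes>\<^bsub>P\<^esub> inv\<^bsub>P\<^esub> f ?l"
        using vc lc(1) by (simp only: f.hom_mult f.hom_inv f.G.inv_closed)
      then show "f (?v \<otimes>\<^bsub>U\<^esub> inv\<^bsub>U\<^esub> ?l) = \<one>\<^bsub>P\<^esub>" unfolding fv lc(2) by simp
      have "g ?v \<in> M #>\<^bsub>Q\<^esub> g ?l"
        using g.H.rcos_self[OF g.hom_closed[OF vc] M.subgroup_axioms] l by simp
      from M.rcos_module_imp[OF g.H.is_group g.hom_closed[OF lc(1)] this]
      show "g (?v \<otimes>\<^bsub>U\<^esub> inv\<^bsub>U\<^esub> ?l) \<in> M" using vc lc(1) by (simp only: g.hom_mult g.hom_inv f.G.inv_closed)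
    qed
    have lc: "?l \<in> carrier U" and bc: "?b \<in> carrier U" using l b by auto
    have "u = (d \<otimes>\<^bsub>U\<^esub> (?v \<otimes>\<^bsub>U\<^esub> inv\<^bsub>U\<^esub> ?l)) \<otimes>\<^bsub>U\<^esub> (?l \<otimes>\<^bsub>U\<^esub> ?b)"
    proof -
      have 1: "d \<otimes>\<^bsub>U\<^esub> ?v = ?w" using dc wc by simp
      have "(d \<otimes>\<^bsub>U\<^esub> (?v \<otimes>\<^bsub>U\<^esub> inv\<^bsub>U\<^esub> ?l)) \<otimes>\<^bsub>U\<^esub> (?l \<otimes>\<^bsub>U\<^esub> ?b) = (d \<otimes>\<^bsub>U\<^esub> ?v) \<otimes>\<^bsub>U\<^esub> (inv\<^bsub>U\<^esub> ?l \<otimes>\<^bsub>U\<^esub> (?l \<otimes>\<^bsub>U\<^esub> ?b))"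
        using dc vc lc bc by (simp only: f.G.m_assoc f.G.m_closed f.G.inv_closed)
      also have "\<dots> = ?w \<otimes>\<^bsub>U\<^esub> ?b" unfolding 1 using lc bc by simp
      also have "\<dots> = u" using u(1) bc by (simp add: f.G.m_assoc)
      finally show ?thesis by simp
    qed
    moreover have "d \<otimes>\<^bsub>U\<^esub> (?v \<otimes>\<^bsub>U\<^esub> inv\<^bsub>U\<^esub> ?l) \<in> ?DU" by (rule DU.m_closed[OF d(1) vl])
    ultimately have "u \<in> ?DU #>\<^bsub>U\<^esub> (?l \<otimes>\<^bsub>U\<^esub> ?b)" unfolding r_coset_def by blast
    then have "x = ?DU #>\<^bsub>U\<^esub> (?l \<otimes>\<^bsub>U\<^esub> ?b)"
      unfolding u(2) by (rule f.G.repr_independence[OF _ f.G.m_closed[OF lc bc] DU.subgroup_axioms, symmetric])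
    moreover have "(cls u, ?k) \<in> ?T" using tP tQ kK by (simp add: cls_def)
    ultimately show "x \<in> (\<lambda>(c, k). ?DU #>\<^bsub>U\<^esub> (lift k \<otimes>\<^bsub>U\<^esub> base c)) ` ?T"
      by (intro image_eqI[of _ _ "(cls u, ?k)"]) simp_all
  qed
  have finT: "finite ?T" using finP finQ finK by simp
  have "card (torsion (abelianization U)) \<le> card ?T"
    using card_mono[OF finite_imageI[OF finT] cover] card_image_le[OF finT] le_trans by blast
  also have "\<dots> = card (torsion (abelianization P)) * card (torsion (abelianization Q)) * card K"
    by (simp add: card_cartesian_product)
  also have "\<dots> \<le> card (torsion (abelianization P)) * card (torsion (abelianization Q)) * card (carrier ?C) ^ J"
    using J(2) by (rule mult_left_mono) simp
  finally show ?thesis using J(1) unfolding card_C by blast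
qed

section \<open>Indices in a direct product and the limit\<close>

text \<open>Pairs of cosets inject into the cosets of \<open>U\<close>. If two pairs collide, the
  quotients of their representatives form an element of \<open>U\<close>; by \<open>split\<close>
  one coordinate lies in its subgroup, so the cosets on that side agree and that coordinate is the
  identity, which puts the other coordinate into its subgroup as well. The disjunction serves both
  uses: projection to \<open>A\<close> with intersection with \<open>B\<close>, and the
  reverse.\<close>

lemma card_rcosets_DirProd_ge:
  assumes A: "group A" and B: "group B" and U: "subgroup U (A \<times>\<times> B)" "finite (rcosets\<^bsub>A \<times>\<times> B\<^esub> U)"
    and S: "subgroup S A" and T: "subgroup T B"
    and split: "\<And>a b. (a, b) \<in> U \<Longrightarrow>
      (a \<in> S \<and> (a = \<one>\<^bsub>A\<^esub> \<longrightarrow> b \<in> T)) \<or> (b \<in> T \<and> (b = \<one>\<^bsub>B\<^esub> \<longrightarrow> a \<in> S))"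
  shows "finite (rcosets\<^bsub>A\<^esub> S)" "finite (rcosets\<^bsub>B\<^esub> T)"
    "card (rcosets\<^bsub>A\<^esub> S) * card (rcosets\<^bsub>B\<^esub> T) \<le> card (rcosets\<^bsub>A \<times>\<times> B\<^esub> U)"
proof -
  interpret A: group A by fact
  interpret B: group B by fact
  interpret G: group "A \<times>\<times> B" by (rule DirProd_group[OF A B])
  let ?F = "\<lambda>(C, D). U #>\<^bsub>A \<times>\<times> B\<^esub> (coset_rep C, coset_rep D)"
  let ?R = "(rcosets\<^bsub>A\<^esub> S) \<times> (rcosets\<^bsub>B\<^esub> T)"
  have inj: "inj_on ?F ?R"
  proof (rule inj_onI)
    fix x y assume x: "x \<in> ?R" and y: "y \<in> ?R" and eq: "?F x = ?F y"
    obtain C D where CD: "x = (C, D)" "C \<in> rcosets\<^bsub>A\<^esub> S" "D \<in> rcosets\<^bsub>B\<^esub> T" using x by blast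
    obtain C' D' where CD': "y = (C', D')" "C' \<in> rcosets\<^bsub>A\<^esub> S" "D' \<in> rcosets\<^bsub>B\<^esub> T" using y by blast
    note C = A.coset_rep[OF S CD(2)] and D = B.coset_rep[OF T CD(3)]
      and C' = A.coset_rep[OF S CD'(2)] and D' = B.coset_rep[OF T CD'(3)]
    let ?a = "coset_rep C \<otimes>\<^bsub>A\<^esub> inv\<^bsub>A\<^esub> coset_rep C'" and ?b = "coset_rep D \<otimes>\<^bsub>B\<^esub> inv\<^bsub>B\<^esub> coset_rep D'"
    have m: "(coset_rep C, coset_rep D) \<in> carrier (A \<times>\<times> B)" "(coset_rep C', coset_rep D') \<in> carrier (A \<times>\<times> B)"
      using C(2) D(2) C'(2) D'(2) by simp_all
    have "(coset_rep C, coset_rep D) \<in> U #>\<^bsub>A \<times>\<times> B\<^esub> (coset_rep C', coset_rep D')"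
      using G.rcos_self[OF m(1) U(1)] eq CD(1) CD'(1) by simp
    from subgroup.rcos_module_imp[OF U(1) G.is_group m(2) this]
    have ab: "(?a, ?b) \<in> U" using inv_DirProd[OF A B C'(2) D'(2)] by simp
    have 1: "C = C' \<and> ?a = \<one>\<^bsub>A\<^esub>" if "?a \<in> S"
    proof -
      have "coset_rep C \<in> S #>\<^bsub>A\<^esub> coset_rep C'"
        using subgroup.rcos_module_rev[OF S A.is_group C'(2) C(2) that] .
      then have "S #>\<^bsub>A\<^esub> coset_rep C' = S #>\<^bsub>A\<^esub> coset_rep C"
        by (rule A.repr_independence[OF _ C'(2) S])
      then have "C = C'" using C(3) C'(3) by simp
      then show ?thesis using C(2) by simp
    qed
    have 2: "D = D' \<and> ?b = \<one>\<^bsub>B\<^esub>" if "?b \<in> T"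
    proof -
      have "coset_rep D \<in> T #>\<^bsub>B\<^esub> coset_rep D'"
        using subgroup.rcos_module_rev[OF T B.is_group D'(2) D(2) that] .
      then have "T #>\<^bsub>B\<^esub> coset_rep D' = T #>\<^bsub>B\<^esub> coset_rep D"
        by (rule B.repr_independence[OF _ D'(2) T])
      then have "D = D'" using D(3) D'(3) by simp
      then show ?thesis using D(2) by simp
    qed
    show "x = y" using split[OF ab] 1 2 CD(1) CD'(1) by blast
  qed
  have into: "?F ` ?R \<subseteq> rcosets\<^bsub>A \<times>\<times> B\<^esub> U"
  proof (rule image_subsetI)
    fix x assume "x \<in> ?R"
    then obtain C D where CD: "x = (C, D)" "C \<in> rcosets\<^bsub>A\<^esub> S" "D \<in> rcosets\<^bsub>B\<^esub> T" by blast
    then show "?F x \<in> rcosets\<^bsub>A \<times>\<times> B\<^esub> U"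
      using G.rcosetsI[OF subgroup.subset[OF U(1)], of "(coset_rep C, coset_rep D)"]
        A.coset_rep(2)[OF S CD(2)] B.coset_rep(2)[OF T CD(3)] by simp
  qed
  have fin: "finite ?R" by (rule finite_imageD[OF finite_subset[OF into U(2)] inj])
  have "S \<in> rcosets\<^bsub>A\<^esub> S" "T \<in> rcosets\<^bsub>B\<^esub> T"
    using subgroup.subgroup_in_rcosets[OF S A] subgroup.subgroup_in_rcosets[OF T B] by auto
  then show "finite (rcosets\<^bsub>A\<^esub> S)" "finite (rcosets\<^bsub>B\<^esub> T)"
    using fin finite_cartesian_productD1 finite_cartesian_productD2 by blast+
  have "card ?R = card (?F ` ?R)" by (rule card_image[OF inj, symmetric])
  also have "\<dots> \<le> card (rcosets\<^bsub>A \<times>\<times> B\<^esub> U)" by (rule card_mono[OF U(2) into])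
  finally show "card (rcosets\<^bsub>A\<^esub> S) * card (rcosets\<^bsub>B\<^esub> T) \<le> card (rcosets\<^bsub>A \<times>\<times> B\<^esub> U)"
    by (simp add: card_cartesian_product)
qed

lemma card_rcosets_pos:
  assumes "group G" and "subgroup H G" and "finite (rcosets\<^bsub>G\<^esub> H)"
  shows "card (rcosets\<^bsub>G\<^esub> H) > 0"
  using subgroup.subgroup_in_rcosets[OF assms(2,1)] assms(3) by (auto simp: card_gt_0_iff)

text \<open>The first two terms come from [A : P] [B : N] <= m and [A : M] [B : Q] <= m, the third
  from a power whose base is at most \<open>m\<close> and whose exponent is at most the binary
  logarithm of \<open>m\<close>.\<close>

lemma ln_card_torsion_subgroup_DirProd_le:
  fixes A :: "('a, 'c) monoid_scheme" and B :: "('b, 'd) monoid_scheme" and c1 c2 :: nat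
  assumes A: "group A" and B: "group B" and c: "c1 > 0" "c2 > 0"
    and TA: "\<And>H. subgroup H A \<Longrightarrow> finite (rcosets\<^bsub>A\<^esub> H) \<Longrightarrow>
      finite (torsion (abelianization (A\<lparr>carrier := H\<rparr>))) \<and>
      card (torsion (abelianization (A\<lparr>carrier := H\<rparr>))) \<le> c1 ^ card (rcosets\<^bsub>A\<^esub> H)"
    and TB: "\<And>H. subgroup H B \<Longrightarrow> finite (rcosets\<^bsub>B\<^esub> H) \<Longrightarrow>
      finite (torsion (abelianization (B\<lparr>carrier := H\<rparr>))) \<and>
      card (torsion (abelianization (B\<lparr>carrier := H\<rparr>))) \<le> c2 ^ card (rcosets\<^bsub>B\<^esub> H)"
    and U: "subgroup U (A \<times>\<times> B)" and fin: "finite (rcosets\<^bsub>A \<times>\<times> B\<^esub> U)"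
  defines "M \<equiv> {a \<in> carrier A. (a, \<one>\<^bsub>B\<^esub>) \<in> U}" and "N \<equiv> {b \<in> carrier B. (\<one>\<^bsub>A\<^esub>, b) \<in> U}"
    and "m \<equiv> real (card (rcosets\<^bsub>A \<times>\<times> B\<^esub> U))"
  shows "ln (real (card (torsion (abelianization ((A \<times>\<times> B)\<lparr>carrier := U\<rparr>)))))
      \<le> m / real (card (rcosets\<^bsub>B\<^esub> N)) * ln (real c1) + m / real (card (rcosets\<^bsub>A\<^esub> M)) * ln (real c2)
        + (ln m)\<^sup>2 / ln 2"
    and "card (rcosets\<^bsub>B\<^esub> N) \<le> card (rcosets\<^bsub>A \<times>\<times> B\<^esub> U)"
proof -
  interpret A: group A by fact
  interpret B: group B by fact
  interpret G: group "A \<times>\<times> B" by (rule DirProd_group[OF A B])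
  interpret U: subgroup U "A \<times>\<times> B" by fact
  let ?GU = "(A \<times>\<times> B)\<lparr>carrier := U\<rparr>"
  interpret GU: group ?GU by (rule G.subgroup_imp_group[OF U])
  define P where "P = fst ` U"
  define Q where "Q = snd ` U"
  let ?GP = "A\<lparr>carrier := P\<rparr>" and ?GQ = "B\<lparr>carrier := Q\<rparr>"
  have fst_hom: "group_hom (A \<times>\<times> B) A fst" and snd_hom: "group_hom (A \<times>\<times> B) B snd"
    by (intro group_hom.intro group_hom_axioms.intro G.is_group A B; auto simp: hom_def DirProd_def)+
  have P: "subgroup P A" unfolding P_def by (rule group_hom.subgroup_img_is_subgroup[OF fst_hom U])
  have Q: "subgroup Q B" unfolding Q_def by (rule group_hom.subgroup_img_is_subgroup[OF snd_hom U])
  interpret GP: group ?GP by (rule A.subgroup_imp_group[OF P])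
  interpret GQ: group ?GQ by (rule B.subgroup_imp_group[OF Q])
  have f: "group_hom ?GU ?GP fst"
    by (intro group_hom.intro group_hom_axioms.intro GU.is_group GP.is_group) (auto simp: hom_def DirProd_def P_def)
  have g: "group_hom ?GU ?GQ snd"
    by (intro group_hom.intro group_hom_axioms.intro GU.is_group GQ.is_group) (auto simp: hom_def DirProd_def Q_def)
  have UC: "a \<in> carrier A \<and> b \<in> carrier B" if "(a, b) \<in> U" for a b using U.mem_carrier[OF that] by simp
  have M: "subgroup M A"
  proof -
    have h: "group_hom A (A \<times>\<times> B) (\<lambda>a. (a, \<one>\<^bsub>B\<^esub>))"
      by (intro group_hom.intro group_hom_axioms.intro G.is_group A) (auto simp: hom_def)
    show ?thesis using group_hom.subgroup_preimage[OF h U] by (simp add: M_def)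
  qed
  have N: "subgroup N B"
  proof -
    have h: "group_hom B (A \<times>\<times> B) (\<lambda>b. (\<one>\<^bsub>A\<^esub>, b))"
      by (intro group_hom.intro group_hom_axioms.intro G.is_group B) (auto simp: hom_def)
    show ?thesis using group_hom.subgroup_preimage[OF h U] by (simp add: N_def)
  qed
  have PN: "finite (rcosets\<^bsub>A\<^esub> P)" "finite (rcosets\<^bsub>B\<^esub> N)"
    "card (rcosets\<^bsub>A\<^esub> P) * card (rcosets\<^bsub>B\<^esub> N) \<le> card (rcosets\<^bsub>A \<times>\<times> B\<^esub> U)"
    using UC by (intro card_rcosets_DirProd_ge[OF A B U fin P N]; force simp: P_def N_def)+
  have MQ: "finite (rcosets\<^bsub>A\<^esub> M)" "finite (rcosets\<^bsub>B\<^esub> Q)"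
    "card (rcosets\<^bsub>A\<^esub> M) * card (rcosets\<^bsub>B\<^esub> Q) \<le> card (rcosets\<^bsub>A \<times>\<times> B\<^esub> U)"
    using UC by (intro card_rcosets_DirProd_ge[OF A B U fin M Q]; force simp: Q_def M_def)+
  note pos = card_rcosets_pos[OF A P PN(1)] card_rcosets_pos[OF B N PN(2)]
    card_rcosets_pos[OF A M MQ(1)] card_rcosets_pos[OF B Q MQ(2)]
  have N_le: "card (rcosets\<^bsub>B\<^esub> N) \<le> card (rcosets\<^bsub>A \<times>\<times> B\<^esub> U)"
    using PN(3) pos(1) by (metis One_nat_def Suc_leI le_trans mult_le_mono1 nat_mult_1)
  then show "card (rcosets\<^bsub>B\<^esub> N) \<le> card (rcosets\<^bsub>A \<times>\<times> B\<^esub> U)" .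

  have ker: "snd ` kernel ?GU ?GP fst = N"
    unfolding kernel_def N_def using UC by force
  have NQ: "N \<subseteq> Q" unfolding N_def Q_def by force
  have NGQ: "subgroup N ?GQ" by (rule B.subgroup_incl[OF N Q NQ])
  \<comment> \<open>Cosets of \<open>N\<close> in \<open>Q\<close> are among its cosets in
    \<open>B\<close>, so by \<open>N_le\<close> their number is at most the index of
    \<open>U\<close>.\<close>
  have sub: "rcosets\<^bsub>?GQ\<^esub> N \<subseteq> rcosets\<^bsub>B\<^esub> N"
    unfolding RCOSETS_def using subgroup.subset[OF Q] by auto
  have finN: "finite (rcosets\<^bsub>?GQ\<^esub> N)" by (rule finite_subset[OF sub PN(2)])
  define F where "F = card (rcosets\<^bsub>?GQ\<^esub> N)"
  have F: "F > 0" "F \<le> card (rcosets\<^bsub>A \<times>\<times> B\<^esub> U)"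
    using card_rcosets_pos[OF GQ.is_group NGQ finN] card_mono[OF PN(2) sub] N_le by (simp_all add: F_def)
  note TP = TA[OF P PN(1)] and TQ = TB[OF Q MQ(2)]
  let ?t = "card (torsion (abelianization ?GU))"
  obtain J where J: "2 ^ J \<le> F" and t: "?t \<le> card (torsion (abelianization ?GP)) * card (torsion (abelianization ?GQ)) * F ^ J"
  proof -
    have "\<exists>J. 2 ^ J \<le> card (rcosets\<^bsub>?GQ\<^esub> (snd ` kernel ?GU ?GP fst)) \<and>
      ?t \<le> card (torsion (abelianization ?GP)) * card (torsion (abelianization ?GQ))
        * card (rcosets\<^bsub>?GQ\<^esub> (snd ` kernel ?GU ?GP fst)) ^ J"
    proof (rule card_torsion_subdirect[OF f _ g])
      show "fst ` carrier ?GU = carrier ?GP" "snd ` carrier ?GU = carrier ?GQ" by (simp_all add: P_def Q_def)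
      show "finite (torsion (abelianization ?GP))" "finite (torsion (abelianization ?GQ))"
        using TP TQ by simp_all
      show "finite (rcosets\<^bsub>?GQ\<^esub> (snd ` kernel ?GU ?GP fst))" unfolding ker by (rule finN)
      show "u = \<one>\<^bsub>?GU\<^esub>" if "u \<in> carrier ?GU" "fst u = \<one>\<^bsub>?GP\<^esub>" "snd u = \<one>\<^bsub>?GQ\<^esub>" for u
        using that by (simp add: prod_eq_iff)
    qed
    then show thesis using that unfolding ker F_def by blast
  qed
  define a where "a = card (rcosets\<^bsub>A\<^esub> P)"
  define d where "d = card (rcosets\<^bsub>B\<^esub> Q)"
  have "?t \<le> c1 ^ a * c2 ^ d * F ^ J"
  proof -
    have "card (torsion (abelianization ?GP)) * card (torsion (abelianization ?GQ)) * F ^ J \<le> c1 ^ a * c2 ^ d * F ^ J"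
      using TP TQ unfolding a_def d_def by (intro mult_le_mono) simp_all
    from le_trans[OF t this] show ?thesis .
  qed
  then have t_le: "real ?t \<le> real c1 ^ a * real c2 ^ d * real F ^ J"
    by (metis of_nat_le_iff of_nat_mult of_nat_power)
  have ln_eq: "ln (real c1 ^ a * real c2 ^ d * real F ^ J) = real a * ln (real c1) + real d * ln (real c2) + real J * ln (real F)"
    using c F by (simp add: ln_mult ln_realpow)
  have 1: "ln (real ?t) \<le> real a * ln (real c1) + real d * ln (real c2) + real J * ln (real F)"
  proof (cases "?t = 0")
    \<comment> \<open>Here \<open>ln 0\<close> is 0, and the right-hand side is nonnegative because
      \<open>c1\<close>, \<open>c2\<close> and \<open>F\<close> are at least 1.\<close>
    case True
    then show ?thesis using c F by (simp add: Suc_leI)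
  next
    case False
    then have "ln (real ?t) \<le> ln (real c1 ^ a * real c2 ^ d * real F ^ J)"
      using t_le c F by (subst ln_le_cancel_iff) simp_all
    then show ?thesis unfolding ln_eq .
  qed
  have m: "m > 0" "real F \<le> m" using F by (simp_all add: m_def)
  have 2: "real a * ln (real c1) \<le> m / real (card (rcosets\<^bsub>B\<^esub> N)) * ln (real c1)"
  proof (rule mult_right_mono)
    have "real a * real (card (rcosets\<^bsub>B\<^esub> N)) \<le> m" using PN(3) unfolding a_def m_def by (metis of_nat_le_iff of_nat_mult)
    then show "real a \<le> m / real (card (rcosets\<^bsub>B\<^esub> N))" using pos(2) by (simp add: pos_le_divide_eq)
  qed (use c in simp)
  have 3: "real d * ln (real c2) \<le> m / real (card (rcosets\<^bsub>A\<^esub> M)) * ln (real c2)"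
  proof (rule mult_right_mono)
    have "real (card (rcosets\<^bsub>A\<^esub> M)) * real d \<le> m" using MQ(3) unfolding d_def m_def by (metis of_nat_le_iff of_nat_mult)
    then show "real d \<le> m / real (card (rcosets\<^bsub>A\<^esub> M))" using pos(3) by (simp add: pos_le_divide_eq mult.commute)
  qed (use c in simp)
  have 4: "real J * ln (real F) \<le> (ln m)\<^sup>2 / ln 2"
  proof -
    have lnF: "0 \<le> ln (real F)" "ln (real F) \<le> ln m" using F(1) m by simp_all
    have "(2::real) ^ J \<le> real F" using J by (metis of_nat_le_iff of_nat_numeral of_nat_power)
    then have "ln ((2::real) ^ J) \<le> ln (real F)" using F(1) by (subst ln_le_cancel_iff) simp_all
    then have "real J * ln 2 \<le> ln m" using lnF by (simp add: ln_realpow)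
    then have "real J \<le> ln m / ln 2" by (simp add: pos_le_divide_eq)
    then have "real J * ln (real F) \<le> ln m / ln 2 * ln m" using lnF by (intro mult_mono) simp_all
    then show ?thesis by (simp add: power2_eq_square)
  qed
  show "ln (real ?t)
      \<le> m / real (card (rcosets\<^bsub>B\<^esub> N)) * ln (real c1) + m / real (card (rcosets\<^bsub>A\<^esub> M)) * ln (real c2)
        + (ln m)\<^sup>2 / ln 2"
    using 1 2 3 4 by linarith
qed

theorem theorem1p2:
  fixes A :: "'a monoid" and B :: "'b monoid" and U :: "nat \<Rightarrow> ('a \<times> 'b) set"
  assumes "finitely_presented A" and "finitely_presented B"
    and "\<And>n. n \<ge> 1 \<Longrightarrow> subgroup (U n) (A \<times>\<times> B)"
    and "\<And>n. n \<ge> 1 \<Longrightarrow> finite (rcosets\<^bsub>A \<times>\<times> B\<^esub> (U n))"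
    and "filterlim (\<lambda>n. card (rcosets\<^bsub>A\<^esub> {a \<in> carrier A. (a, \<one>\<^bsub>B\<^esub>) \<in> U n})) at_top sequentially"
    and "filterlim (\<lambda>n. card (rcosets\<^bsub>B\<^esub> {b \<in> carrier B. (\<one>\<^bsub>A\<^esub>, b) \<in> U n})) at_top sequentially"
  shows "(\<lambda>n. ln (real (card (torsion (abelianization ((A \<times>\<times> B)\<lparr>carrier := U n\<rparr>)))))
              / real (card (rcosets\<^bsub>A \<times>\<times> B\<^esub> (U n)))) \<longlonglongrightarrow> 0"
proof -
  have A: "group A" and B: "group B" using assms(1,2) by (simp_all add: finitely_presented_def)
  obtain c1 :: nat where c1: "c1 > 0" "\<And>H. subgroup H A \<Longrightarrow> finite (rcosets\<^bsub>A\<^esub> H) \<Longrightarrow>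
      finite (torsion (abelianization (A\<lparr>carrier := H\<rparr>))) \<and>
      card (torsion (abelianization (A\<lparr>carrier := H\<rparr>))) \<le> c1 ^ card (rcosets\<^bsub>A\<^esub> H)"
    using finitely_presented_torsion_bound[OF assms(1)] by blast
  obtain c2 :: nat where c2: "c2 > 0" "\<And>H. subgroup H B \<Longrightarrow> finite (rcosets\<^bsub>B\<^esub> H) \<Longrightarrow>
      finite (torsion (abelianization (B\<lparr>carrier := H\<rparr>))) \<and>
      card (torsion (abelianization (B\<lparr>carrier := H\<rparr>))) \<le> c2 ^ card (rcosets\<^bsub>B\<^esub> H)"
    using finitely_presented_torsion_bound[OF assms(2)] by blast
  define a where "a n = card (rcosets\<^bsub>A\<^esub> {a \<in> carrier A. (a, \<one>\<^bsub>B\<^esub>) \<in> U n})" for n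
  define b where "b n = card (rcosets\<^bsub>B\<^esub> {b \<in> carrier B. (\<one>\<^bsub>A\<^esub>, b) \<in> U n})" for n
  define m where "m n = card (rcosets\<^bsub>A \<times>\<times> B\<^esub> (U n))" for n
  define t where "t n = card (torsion (abelianization ((A \<times>\<times> B)\<lparr>carrier := U n\<rparr>)))" for n
  have bound: "ln (real (t n)) \<le> real (m n) / real (b n) * ln (real c1) + real (m n) / real (a n) * ln (real c2)
      + (ln (real (m n)))\<^sup>2 / ln 2" "b n \<le> m n" if "n \<ge> 1" for n
    unfolding a_def b_def m_def t_def
    using ln_card_torsion_subgroup_DirProd_le[OF A B c1(1) c2(1) c1(2) c2(2) assms(3)[OF that] assms(4)[OF that]]
    by simp_all
  have lim_a: "filterlim (\<lambda>n. real (a n)) at_top sequentially"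
    using filterlim_compose[OF filterlim_real_sequentially assms(5)] by (simp add: a_def)
  have lim_b: "filterlim (\<lambda>n. real (b n)) at_top sequentially"
    using filterlim_compose[OF filterlim_real_sequentially assms(6)] by (simp add: b_def)
  \<comment> \<open>The index of \<open>U n\<close> dominates \<open>b n\<close>; its divergence
    makes the squared logarithm negligible.\<close>
  have lim_m: "filterlim (\<lambda>n. real (m n)) at_top sequentially"
    using bound(2) by (intro filterlim_at_top_mono[OF lim_b] eventually_sequentiallyI[of 1]) simp
  have "((\<lambda>x::real. (ln x)\<^sup>2 / x) \<longlongrightarrow> 0) at_top" by real_asymp
  from filterlim_compose[OF this lim_m]
  have "(\<lambda>n. ln (real c1) / real (b n) + ln (real c2) / real (a n) + (ln (real (m n)))\<^sup>2 / real (m n) / ln 2)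
      \<longlonglongrightarrow> 0 + 0 + 0 / ln 2"
    by (intro tendsto_add tendsto_divide_0[OF tendsto_const] tendsto_divide tendsto_const
        filterlim_at_top_imp_at_infinity lim_a lim_b) simp_all
  then have lim: "(\<lambda>n. ln (real c1) / real (b n) + ln (real c2) / real (a n) + (ln (real (m n)))\<^sup>2 / real (m n) / ln 2)
      \<longlonglongrightarrow> 0" by simp
  have "(\<lambda>n. ln (real (t n)) / real (m n)) \<longlonglongrightarrow> 0"
  proof (rule real_tendsto_sandwich[OF _ _ tendsto_const lim])
    show "\<forall>\<^sub>F n in sequentially. 0 \<le> ln (real (t n)) / real (m n)"
    proof (rule always_eventually, rule allI)
      fix n show "0 \<le> ln (real (t n)) / real (m n)" by (cases "t n = 0") simp_all
    qed
    \<comment> \<open>As \<open>b n\<close> is at most \<open>m n\<close>, this makes the divisor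
      positive.\<close>
    have "\<forall>\<^sub>F n in sequentially. real (b n) \<ge> 1" using lim_b unfolding filterlim_at_top by blast
    with eventually_ge_at_top[of 1]
    show "\<forall>\<^sub>F n in sequentially. ln (real (t n)) / real (m n)
        \<le> ln (real c1) / real (b n) + ln (real c2) / real (a n) + (ln (real (m n)))\<^sup>2 / real (m n) / ln 2"
    proof eventually_elim
      case (elim n)
      have m: "real (m n) > 0" using bound(2)[OF elim(1)] elim(2) by simp
      have "ln (real (t n)) / real (m n) \<le> (real (m n) / real (b n) * ln (real c1) + real (m n) / real (a n) * ln (real c2)
          + (ln (real (m n)))\<^sup>2 / ln 2) / real (m n)"
        using bound(1)[OF elim(1)] m by (intro divide_right_mono) simp_all
      also have "\<dots> = ln (real c1) / real (b n) + ln (real c2) / real (a n) + (ln (real (m n)))\<^sup>2 / real (m n) / ln 2"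
        using m by (simp add: add_divide_distrib)
      finally show ?case .
    qed
  qed
  then show ?thesis by (simp add: t_def m_def)
qed

end
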